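(* Let $1<p_i\leq q_i<\infty$, $i=1,2$, with $p_1\leq p_2$ and $\frac{q_1}{p_1'}=\frac{q_2}{p_2'}$. Then $$[W]_{A_{p_1,q_1}}\leq[W]_{A_{p_2,q_2}}$$ for all $d\times d$ matrix weights $W$ on $\mathbb{R}^n$. In the case $p_1<p_2$, one can find a $2\times2$ matrix weight $W$ on $\mathbb{R}$ with $[W]_{A_{p_1,q_1}}<\infty$ and $[W]_{A_{p_2,q_2}}=\infty$.
   Context: $p'$ is the Hölder conjugate of $p$; $|A|$ is the spectral norm of a matrix $A$. A $d\times d$ matrix weight on $\mathbb{R}^n$ is a locally integrable function $W:\mathbb{R}^n\to M_d(\mathbb{C})$ with $W(x)$ positive definite for a.e. $x$. For $1<p\leq q<\infty$, $$[W]_{A_{p,q}}:=\sup_Q\frac1{|Q|}\int_Q\left(\frac1{|Q|}\int_Q|W(x)^{1/q}W(y)^{-1/q}|^{p'}\,\mathrm{d}y\right)^{q/p'}\mathrm{d}x\in[0,\infty],$$ supremum over all cubes $Q\subseteq\mathbb{R}^n$ with faces parallel to the coordinate hyperplanes (intervals if $n=1$). *)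

theory Defs
  imports "HOL-Analysis.Analysis"
begin

definition adj_mat :: "complex^'m^'n \<Rightarrow> complex^'n^'m" where
  "adj_mat A = (\<chi> i j. cnj (A $ j $ i))"

definition unitary_mat :: "complex^'d^'d \<Rightarrow> bool" where
  "unitary_mat U \<longleftrightarrow> adj_mat U ** U = mat 1 \<and> U ** adj_mat U = mat 1"

definition diag_mat :: "('d \<Rightarrow> real) \<Rightarrow> complex^'d^'d" where
  "diag_mat l = (\<chi> i j. if i = j then complex_of_real (l i) else 0)"

text \<open>For Hermitian \<open>A\<close> the number \<open>v\<^sup>* A v\<close> is real, so taking \<open>Re\<close> loses nothing.\<close>

definition posdef_mat :: "complex^'d^'d \<Rightarrow> bool" where
  "posdef_mat A \<longleftrightarrow> adj_mat A = A \<and>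
     (\<forall>v. v \<noteq> 0 \<longrightarrow> 0 < Re (\<Sum>i\<in>UNIV. cnj (v $ i) * (A *v v) $ i))"

text \<open>The real power \<open>A\<^sup>s = U diag(l\<^sub>i\<^sup>s) U\<^sup>*\<close> of a positive definite matrix
  \<open>A = U diag(l\<^sub>i) U\<^sup>*\<close>. The result does not depend on the chosen
  diagonalisation; the value is unspecified if \<open>A\<close> is not positive definite.\<close>

definition mat_powr :: "complex^'d^'d \<Rightarrow> real \<Rightarrow> complex^'d^'d" where
  "mat_powr A s = (THE B. \<exists>U l. unitary_mat U \<and> (\<forall>i. 0 < l i) \<and>
     A = U ** diag_mat l ** adj_mat U \<and>
     B = U ** diag_mat (\<lambda>i. l i powr s) ** adj_mat U)"

text \<open>The norm on \<open>complex^'d\<close> is the Euclidean one, so its operator norm is the spectral norm.\<close>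

definition spectral_norm :: "complex^'d^'d \<Rightarrow> real" where
  "spectral_norm A = onorm (\<lambda>v. A *v v)"

definition matrix_weight :: "('a::euclidean_space \<Rightarrow> complex^'d^'d) \<Rightarrow> bool" where
  "matrix_weight W \<longleftrightarrow>
     (\<forall>K. compact K \<longrightarrow> W absolutely_integrable_on K) \<and>
     (AE x in lebesgue. posdef_mat (W x))"

definition conj_exp :: "real \<Rightarrow> real" where
  "conj_exp p = p / (p - 1)"

text \<open>Closed, nondegenerate, axis-parallel cubes; the faces are null sets. In
  \<open>real\<close> these are the intervals \<open>{a..a + r}\<close>.\<close>

definition cubes :: "'a::euclidean_space set set" where
  "cubes = {cbox a (a + r *\<^sub>R One) | a r. 0 < r}"

text \<open>Used for exponents \<open>r > 0\<close> only.\<close>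

definition ennreal_powr :: "ennreal \<Rightarrow> real \<Rightarrow> ennreal" where
  "ennreal_powr x r = (if x = \<infinity> then \<infinity> else ennreal (enn2real x powr r))"

definition avg :: "'a::euclidean_space set \<Rightarrow> ('a \<Rightarrow> ennreal) \<Rightarrow> ennreal" where
  "avg Q f = (\<integral>\<^sup>+x\<in>Q. f x \<partial>lebesgue) / emeasure lebesgue Q"

definition Apq_const ::
    "real \<Rightarrow> real \<Rightarrow> ('a::euclidean_space \<Rightarrow> complex^'d^'d) \<Rightarrow> ennreal" where
  "Apq_const p q W =
     (SUP Q\<in>cubes. avg Q (\<lambda>x. ennreal_powr
        (avg Q (\<lambda>y. ennreal
           (spectral_norm (mat_powr (W x) (1 / q) ** mat_powr (W y) (- 1 / q)) powr conj_exp p)))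
        (q / conj_exp p)))"

end

theory Submission
  imports Defs
begin

text \<open>The condition on the exponents says that \<open>q1 / p1' = q2 / p2' = r\<close>, so the outer
  exponents of the two characteristics agree and only the integrands
  \<open>|W(x)\<^sup>s W(y)\<^sup>-\<^sup>s|\<close>, with \<open>s = 1/q\<close>, raised to the power \<open>p' = 1/(r s)\<close>,
  differ. The Cordes inequality \<open>|A\<^sup>t B\<^sup>t| \<le> |A B|\<^sup>t\<close>, for positive definite matrices and
  \<open>0 \<le> t \<le> 1\<close>, says that passing from the larger \<open>s = 1/q2\<close> to the smaller
  \<open>s = 1/q1\<close> decreases the integrand pointwise (\<open>Cordes_inequality\<close>,
  \<open>Apq_const_mono\<close>). It holds because \<open>s \<mapsto> ln |A\<^sup>s B\<^sup>s|\<close> is midpoint convex, by a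
  spectral radius argument (\<open>spectral_norm_powr_midpoint\<close>), and bounded on bounded intervals. Since
  real powers are defined through diagonalisations, this rests on the spectral theorem, which is
  derived by maximising \<open>|A v|\<close> over orthogonal complements of the eigenvectors already found.

  For the strictness write \<open>W\<close> in an orthonormal eigenbasis \<open>e\<^sub>i(x)\<close> with eigenvalues
  \<open>a\<^sub>i(x)\<close>. Up to constants the integrand is then the sum over \<open>i, j\<close> of
  \<open>(a\<^sub>i(x) / a\<^sub>j(y))\<^bsup>1/r\<^esup> |\<langle>e\<^sub>i(x), e\<^sub>j(y)\<rangle>|\<^bsup>p'\<^esup>\<close>,
  so the exponents act only through the power \<open>p'\<close> on the inner product of eigenvectors.
  Passing from \<open>p2'\<close> to the larger \<open>p1'\<close> makes the mixed terms smaller. On the line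
  take the eigenvalues \<open>|x|\<^bsup>-1/2\<^esup>\<close> and \<open>1\<close> near the origin, and
  let the eigenvectors be constant on the left and turned by an angle of size
  \<open>x\<^sup>\<kappa>\<close> on the right. For \<open>x \<approx> -h\<close> and \<open>y \<approx> h\<close> the mixed
  term \<open>|W(x)\<^sup>s W(y)\<^sup>-\<^sup>s|\<close> has size \<open>h\<^bsup>\<kappa> - s/2\<^esup>\<close>. With
  \<open>\<kappa> = 1/(2 q1)\<close> this is bounded for \<open>s = 1/q1\<close>
  (\<open>weight_product_core_upper\<close>, \<open>Apq_const_rotating_weight_finite\<close>) and unbounded for
  \<open>s = 1/q2\<close> (\<open>Apq_const_rotating_weight_infinite\<close>).\<close>

section \<open>Adjoints and unitary diagonalisations\<close>

lemma adj_mat_mult: "adj_mat (A ** B) = adj_mat B ** adj_mat A"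
  by (simp add: adj_mat_def matrix_matrix_mult_def vec_eq_iff mult.commute)

lemma adj_mat_adj_mat [simp]: "adj_mat (adj_mat A) = A"
  by (simp add: adj_mat_def vec_eq_iff)

lemma adj_mat_diag_mat [simp]: "adj_mat (diag_mat l) = diag_mat l"
  by (auto simp: adj_mat_def diag_mat_def vec_eq_iff)

lemma diag_mat_mult_nth: "(diag_mat l ** A) $ i $ j = complex_of_real (l i) * A $ i $ j"
  by (simp add: diag_mat_def matrix_matrix_mult_def if_distrib if_distribR cong: if_cong)

lemma mult_diag_mat_nth: "(A ** diag_mat l) $ i $ j = A $ i $ j * complex_of_real (l j)"
  by (simp add: diag_mat_def matrix_matrix_mult_def if_distrib if_distribR cong: if_cong)

lemma diag_mat_mult: "diag_mat l ** diag_mat m = diag_mat (\<lambda>i. l i * m i)"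
  by (simp add: vec_eq_iff diag_mat_mult_nth) (simp add: diag_mat_def)

lemma diag_mat_1 [simp]: "diag_mat (\<lambda>i. 1) = mat 1"
  by (simp add: diag_mat_def mat_def vec_eq_iff)

text \<open>Orthogonality of eigenvectors refers to the complex inner product; the library's inner product
  on this space is its real part.\<close>

definition hinner :: "complex^'d \<Rightarrow> complex^'d \<Rightarrow> complex" where
  "hinner v w = (\<Sum>i\<in>UNIV. cnj (v $ i) * w $ i)"

lemma Re_hinner: "Re (hinner v w) = inner v w"
  by (simp add: hinner_def inner_vec_def inner_complex_def)

lemma hinner_self: "hinner v v = complex_of_real ((norm v)\<^sup>2)"
proof -
  have "Im (hinner v v) = 0"
    by (simp add: hinner_def mult.commute)
  then show ?thesis
    by (simp add: complex_eq_iff Re_hinner power2_norm_eq_inner)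
qed

lemma hinner_cnj: "cnj (hinner v w) = hinner w v"
  by (simp add: hinner_def mult.commute)

lemma hinner_diff_right: "hinner v (x - y) = hinner v x - hinner v y"
  by (simp add: hinner_def sum_subtractf algebra_simps)

lemma hinner_add_right: "hinner v (x + y) = hinner v x + hinner v y"
  by (simp add: hinner_def sum.distrib algebra_simps)

lemma hinner_scale_right: "hinner v (c *s x) = c * hinner v x"
  by (simp add: hinner_def sum_distrib_left algebra_simps)

lemma hinner_scaleR_right: "hinner v (c *\<^sub>R x) = of_real c * hinner v x"
  unfolding hinner_def vector_scaleR_component
  by (simp add: sum_distrib_left scaleR_conv_of_real ac_simps)

lemma hinner_sum_right: "hinner v (\<Sum>x\<in>E. f x) = (\<Sum>x\<in>E. hinner v (f x))"
  by (induction E rule: infinite_finite_induct)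
     (simp_all add: hinner_add_right, simp_all add: hinner_def)

lemma hinner_matrix_mult_right: "hinner v (A *v w) = hinner (adj_mat A *v v) w"
proof -
  have "hinner v (A *v w) = (\<Sum>i\<in>UNIV. \<Sum>j\<in>UNIV. cnj (v $ i) * (A $ i $ j * w $ j))"
    by (simp add: hinner_def matrix_vector_mult_def sum_distrib_left)
  also have "\<dots> = (\<Sum>j\<in>UNIV. \<Sum>i\<in>UNIV. cnj (v $ i) * (A $ i $ j * w $ j))"
    by (rule sum.swap)
  also have "\<dots> = hinner (adj_mat A *v v) w"
    by (simp add: hinner_def matrix_vector_mult_def adj_mat_def sum_distrib_right sum_distrib_left ac_simps)
  finally show ?thesis .
qed

lemma inner_matrix_mult_right: "inner v (A *v w) = inner (adj_mat A *v v) w"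
  for A :: "complex^'d^'d"
  by (simp flip: Re_hinner add: hinner_matrix_mult_right)

lemma unitary_mat_norm:
  assumes "unitary_mat U"
  shows "norm (U *v x) = norm x"
proof -
  have "inner (U *v x) (U *v x) = inner (adj_mat U *v (U *v x)) x"
    by (simp add: inner_matrix_mult_right)
  also have "\<dots> = inner x x"
    using assms by (simp add: matrix_vector_mul_assoc unitary_mat_def)
  finally show ?thesis
    by (simp add: norm_eq_sqrt_inner)
qed

lemma unitary_mat_adj: "unitary_mat U \<Longrightarrow> unitary_mat (adj_mat U)"
  by (simp add: unitary_mat_def)

text \<open>Comparing entries of \<open>V\<^sup>* U\<close> shows that it links equal
  eigenvalues only, so it intertwines functions of the eigenvalues as well.\<close>

lemma diagonalisation_fun_unique:
  fixes U V :: "complex^'d^'d"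
  assumes U: "unitary_mat U" and V: "unitary_mat V"
    and eq: "U ** diag_mat l ** adj_mat U = V ** diag_mat m ** adj_mat V"
  shows "U ** diag_mat (\<lambda>i. f (l i)) ** adj_mat U = V ** diag_mat (\<lambda>i. f (m i)) ** adj_mat V"
proof -
  define X where "X = adj_mat V ** U"
  have UU: "adj_mat U ** U = mat 1" "U ** adj_mat U = mat 1"
    and VV: "adj_mat V ** V = mat 1" "V ** adj_mat V = mat 1"
    using U V by (auto simp: unitary_mat_def)
  have "X ** diag_mat l = adj_mat V ** (U ** diag_mat l ** adj_mat U) ** U"
    by (simp add: X_def UU flip: matrix_mul_assoc)
  also have "\<dots> = (adj_mat V ** V) ** diag_mat m ** X"
    unfolding eq by (simp add: X_def matrix_mul_assoc)
  finally have "X ** diag_mat l = diag_mat m ** X"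
    by (simp add: VV)
  then have entry: "X $ i $ j * complex_of_real (l j) = complex_of_real (m i) * X $ i $ j" for i j
    by (metis diag_mat_mult_nth mult_diag_mat_nth)
  \<comment> \<open>A nonzero entry forces the two eigenvalues, hence their images under \<open>f\<close>, to agree.\<close>
  have "X $ i $ j * complex_of_real (f (l j)) = complex_of_real (f (m i)) * X $ i $ j" for i j
    using entry[of i j] by (cases "X $ i $ j = 0") auto
  then have X: "X ** diag_mat (\<lambda>i. f (l i)) = diag_mat (\<lambda>i. f (m i)) ** X"
    by (simp add: vec_eq_iff diag_mat_mult_nth mult_diag_mat_nth)
  have "U ** diag_mat (\<lambda>i. f (l i)) ** adj_mat U
      = (V ** adj_mat V) ** U ** diag_mat (\<lambda>i. f (l i)) ** adj_mat U"
    by (simp add: VV)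
  also have "\<dots> = V ** (X ** diag_mat (\<lambda>i. f (l i))) ** adj_mat U"
    by (simp add: X_def matrix_mul_assoc)
  also have "\<dots> = V ** diag_mat (\<lambda>i. f (m i)) ** adj_mat V ** (U ** adj_mat U)"
    unfolding X by (simp add: X_def matrix_mul_assoc)
  finally show ?thesis
    by (simp add: UU)
qed

lemma mat_powr_diagonalised:
  assumes "unitary_mat U" "\<And>i. 0 < l i"
  shows "mat_powr (U ** diag_mat l ** adj_mat U) s
       = U ** diag_mat (\<lambda>i. l i powr s) ** adj_mat U"
  unfolding mat_powr_def
proof (rule the_equality)
  show "\<exists>V m. unitary_mat V \<and> (\<forall>i. 0 < m i) \<and>
      U ** diag_mat l ** adj_mat U = V ** diag_mat m ** adj_mat V \<and>
      U ** diag_mat (\<lambda>i. l i powr s) ** adj_mat U = V ** diag_mat (\<lambda>i. m i powr s) ** adj_mat V"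
    using assms by blast
next
  fix B
  assume "\<exists>V m. unitary_mat V \<and> (\<forall>i. 0 < m i) \<and>
      U ** diag_mat l ** adj_mat U = V ** diag_mat m ** adj_mat V \<and>
      B = V ** diag_mat (\<lambda>i. m i powr s) ** adj_mat V"
  then show "B = U ** diag_mat (\<lambda>i. l i powr s) ** adj_mat U"
    using diagonalisation_fun_unique[OF assms(1), where f = "\<lambda>x. x powr s"] by metis
qed

section \<open>The spectral theorem for positive definite matrices\<close>

text \<open>If \<open>|T v|\<close> is maximal over the unit sphere of \<open>S\<close> with value
  \<open>\<sigma>\<close>, then \<open>|T' T v| \<le> \<sigma>\<^sup>2\<close> by adjointness, and expanding
  \<open>|T' T v - \<sigma>\<^sup>2 v|\<^sup>2\<close> forces equality.\<close>

lemma maximal_singular_vector: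
  fixes T T' :: "'a::euclidean_space \<Rightarrow> 'a"
  assumes T: "linear T" and adj: "\<And>x y. inner (T x) y = inner x (T' y)"
    and S: "subspace S" and inv: "\<And>x. x \<in> S \<Longrightarrow> T' (T x) \<in> S" and nz: "\<exists>x\<in>S. x \<noteq> 0"
  obtains v \<sigma> where "v \<in> S" "norm v = 1" "0 \<le> \<sigma>" "T' (T v) = \<sigma>\<^sup>2 *\<^sub>R v" "norm (T v) = \<sigma>"
    "\<And>u. u \<in> S \<Longrightarrow> norm (T u) \<le> \<sigma> * norm u"
proof -
  define K where "K = S \<inter> sphere 0 1"
  have "compact K"
    unfolding K_def using S closed_subspace by (intro closed_Int_compact) auto
  moreover have "K \<noteq> {}"
  proof -
    obtain x where "x \<in> S" "x \<noteq> 0"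
      using nz by blast
    then have "(1 / norm x) *\<^sub>R x \<in> K"
      using S by (auto simp: K_def subspace_scale)
    then show ?thesis by blast
  qed
  moreover have "continuous_on K (\<lambda>x. norm (T x))"
    by (intro continuous_on_norm linear_continuous_on T linear_linear[THEN iffD2])
  ultimately obtain v where v: "v \<in> K" and max: "\<And>u. u \<in> K \<Longrightarrow> norm (T u) \<le> norm (T v)"
    using continuous_attains_sup[of K "\<lambda>x. norm (T x)"] by blast
  define \<sigma> where "\<sigma> = norm (T v)"
  have bound: "norm (T u) \<le> \<sigma> * norm u" if "u \<in> S" for u
  proof (cases "u = 0")
    case True
    then show ?thesis using T by (simp add: linear_0)
  next
    case False
    then have "(1 / norm u) *\<^sub>R u \<in> K"
      using S that by (auto simp: K_def subspace_scale)
    from max[OF this] show ?thesis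
      using False T by (simp add: \<sigma>_def linear_scale divide_simps mult.commute)
  qed
  have vS: "v \<in> S" and v1: "norm v = 1"
    using v by (auto simp: K_def)
  define w where "w = T' (T v)"
  have "(norm w)\<^sup>2 = inner (T w) (T v)"
    by (simp add: adj power2_norm_eq_inner flip: w_def)
  also have "\<dots> \<le> norm (T w) * norm (T v)"
    by (rule norm_cauchy_schwarz)
  also have "\<dots> \<le> (\<sigma> * norm w) * \<sigma>"
    unfolding \<sigma>_def[symmetric] using inv[OF vS]
    by (intro mult_right_mono bound) (auto simp: w_def \<sigma>_def)
  finally have "norm w * norm w \<le> \<sigma>\<^sup>2 * norm w"
    by (simp add: power2_eq_square ac_simps)
  then have w: "norm w \<le> \<sigma>\<^sup>2"
    by (cases "norm w = 0") auto
  have wv: "inner w v = \<sigma>\<^sup>2"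
    using adj[of v "T v"] by (simp add: w_def \<sigma>_def power2_norm_eq_inner inner_commute)
  have "(norm (w - \<sigma>\<^sup>2 *\<^sub>R v))\<^sup>2 = (norm w)\<^sup>2 - 2 * \<sigma>\<^sup>2 * inner w v + (\<sigma>\<^sup>2)\<^sup>2 * (norm v)\<^sup>2"
    unfolding power2_norm_eq_inner
    by (simp add: inner_diff_left inner_diff_right inner_commute algebra_simps power2_eq_square)
  also have "\<dots> = (norm w)\<^sup>2 - (\<sigma>\<^sup>2)\<^sup>2"
    by (simp add: wv v1 power2_eq_square)
  also have "\<dots> \<le> 0"
    using power_mono[OF w, of 2] by simp
  finally have "w = \<sigma>\<^sup>2 *\<^sub>R v"
    by simp
  then have eig: "T' (T v) = \<sigma>\<^sup>2 *\<^sub>R v"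
    by (simp add: w_def)
  show thesis
    by (rule that[OF vS v1 _ eig _ bound]) (simp_all add: \<sigma>_def)
qed

lemma subspace_hinner_orthogonal: "subspace {v. \<forall>e\<in>E. hinner e v = 0}"
  unfolding subspace_def
  by (auto simp: hinner_add_right hinner_scaleR_right) (simp add: hinner_def)

definition orthonormal :: "(complex^'d) set \<Rightarrow> bool" where
  "orthonormal E \<longleftrightarrow> (\<forall>e\<in>E. \<forall>f\<in>E. hinner e f = (if e = f then 1 else 0))"

text \<open>The residual of the orthogonal projection of a vector outside the span, as in the
  Gram--Schmidt process, is orthogonal to \<open>E\<close>.\<close>

lemma orthonormal_complement_nontrivial:
  fixes E :: "(complex^'d) set"
  assumes "orthonormal E" "finite E" "card E < CARD('d)"
  shows "\<exists>v. v \<noteq> 0 \<and> (\<forall>e\<in>E. hinner e v = 0)"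
proof -
  have "vec.dim (vec.span E) \<le> card E"
    using assms(2) by (intro vec.dim_le_card) auto
  then have "vec.span E \<noteq> UNIV"
    using assms(3) by (metis leD vec_dim_card)
  then obtain x where x: "x \<notin> vec.span E"
    by blast
  define v where "v = x - (\<Sum>e\<in>E. hinner e x *s e)"
  have "v \<noteq> 0"
  proof
    assume "v = 0"
    then have "x = (\<Sum>e\<in>E. hinner e x *s e)"
      by (simp add: v_def)
    also have "\<dots> \<in> vec.span E"
      by (intro vec.span_sum vec.span_scale vec.span_base)
    finally show False
      using x by blast
  qed
  moreover have "hinner e v = 0" if "e \<in> E" for e
  proof -
    have "(\<Sum>f\<in>E. hinner e (hinner f x *s f)) = (\<Sum>f\<in>E. if e = f then hinner e x else 0)"
      using assms(1) that by (intro sum.cong) (auto simp: hinner_scale_right orthonormal_def)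
    then show ?thesis
      using that assms(2) by (simp add: v_def hinner_diff_right hinner_sum_right)
  qed
  ultimately show ?thesis by blast
qed

lemma posdef_mat_hinner:
  assumes "posdef_mat A" "v \<noteq> 0"
  shows "0 < inner v (A *v v)"
  using assms by (simp add: posdef_mat_def hinner_def flip: Re_hinner)

text \<open>For a maximal vector \<open>v\<close> one gets \<open>(A - \<sigma>)(A + \<sigma>) v = 0\<close>, and
  positivity makes \<open>(A + \<sigma>) v\<close> a nonzero eigenvector.\<close>

lemma posdef_eigenvector_in_subspace:
  fixes A :: "complex^'d^'d"
  assumes A: "posdef_mat A" and S: "subspace S" and inv: "\<And>x. x \<in> S \<Longrightarrow> A *v x \<in> S"
    and nz: "\<exists>x\<in>S. x \<noteq> 0"
  obtains w \<mu> where "w \<in> S" "norm w = 1" "0 < \<mu>" "A *v w = \<mu> *\<^sub>R w"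
proof -
  have adjA: "adj_mat A = A"
    using A by (simp add: posdef_mat_def)
  obtain v \<sigma> where v: "v \<in> S" "norm v = 1" "0 \<le> \<sigma>" "A *v (A *v v) = \<sigma>\<^sup>2 *\<^sub>R v"
  proof (rule maximal_singular_vector[of "(*v) A" "(*v) A" S])
    show "linear ((*v) A)"
      using matrix_vector_mul_bounded_linear[of A] by (simp add: bounded_linear.linear)
    show "inner (A *v x) y = inner x (A *v y)" for x y
      by (simp add: inner_matrix_mult_right adjA)
  qed (use S inv nz in auto)
  define w where "w = A *v v + \<sigma> *\<^sub>R v"
  have lin: "linear ((*v) A)"
    using matrix_vector_mul_bounded_linear[of A] by (simp add: bounded_linear.linear)
  have "v \<noteq> 0"
    using v by auto
  then have "0 < inner v w"
    using posdef_mat_hinner[OF A, of v] v by (simp add: w_def inner_add_right add_pos_nonneg)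
  then have w0: "w \<noteq> 0" by auto
  have Aw: "A *v w = \<sigma> *\<^sub>R w"
    unfolding w_def using v lin
    by (simp add: linear_add linear_scale algebra_simps power2_eq_square)
  have "0 < \<sigma> * (norm w)\<^sup>2"
    using posdef_mat_hinner[OF A w0] by (simp add: Aw power2_norm_eq_inner)
  then have "0 < \<sigma>"
    using zero_less_mult_pos2 w0 by (simp add: zero_less_mult_iff)
  moreover have "w \<in> S"
    using v inv S by (simp add: w_def subspace_add subspace_scale)
  ultimately show thesis
    using that[of "(1 / norm w) *\<^sub>R w" \<sigma>] w0 S lin Aw
    by (simp add: subspace_scale linear_scale)
qed

text \<open>Self-adjointness makes the orthogonal complement of a set of eigenvectors invariant, so it
  contains a further eigenvector as long as it is nontrivial.\<close>

lemma posdef_orthonormal_eigenvectors: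
  fixes A :: "complex^'d^'d"
  assumes A: "posdef_mat A" and "k \<le> CARD('d)"
  shows "\<exists>E. finite E \<and> card E = k \<and> orthonormal E \<and> (\<forall>e\<in>E. \<exists>\<mu>>0. A *v e = \<mu> *\<^sub>R e)"
  using assms(2)
proof (induction k)
  case 0
  show ?case by (rule exI[of _ "{}"]) (simp add: orthonormal_def)
next
  case (Suc k)
  from Suc.IH[OF Suc_leD[OF Suc.prems]]
  obtain E where E: "finite E" "card E = k" "orthonormal E"
    "\<forall>e\<in>E. \<exists>\<mu>>0. A *v e = \<mu> *\<^sub>R e"
    by blast
  define S where "S = {v. \<forall>e\<in>E. hinner e v = 0}"
  have adjA: "adj_mat A = A"
    using A by (simp add: posdef_mat_def)
  have inv: "A *v x \<in> S" if x: "x \<in> S" for x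
    unfolding S_def
  proof (intro CollectI ballI)
    fix e assume e: "e \<in> E"
    then obtain \<mu> where "A *v e = \<mu> *\<^sub>R e"
      using E by blast
    then have "hinner e (A *v x) = cnj (hinner x (\<mu> *\<^sub>R e))"
      by (simp add: hinner_matrix_mult_right adjA hinner_cnj)
    also have "\<dots> = of_real \<mu> * hinner e x"
      by (simp add: hinner_scaleR_right hinner_cnj)
    finally show "hinner e (A *v x) = 0"
      using x e by (simp add: S_def)
  qed
  have "\<exists>x\<in>S. x \<noteq> 0"
    using orthonormal_complement_nontrivial[OF E(3,1)] Suc.prems E(2) by (auto simp: S_def)
  then obtain w \<mu> where w: "w \<in> S" "norm w = 1" "0 < \<mu>" "A *v w = \<mu> *\<^sub>R w"
    using posdef_eigenvector_in_subspace[OF A _ inv] subspace_hinner_orthogonal[of E, folded S_def]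
    by blast
  have orth: "hinner e w = 0" "hinner w e = 0" if "e \<in> E" for e
    using w that hinner_cnj[of e w] by (auto simp: S_def)
  have "w \<notin> E"
    using orth[of w] w by (auto simp: hinner_self)
  moreover from this have "orthonormal (insert w E)"
    using E(3) orth w by (auto simp: orthonormal_def hinner_self)
  moreover have "\<forall>e\<in>insert w E. \<exists>\<mu>>0. A *v e = \<mu> *\<^sub>R e"
    using E(4) w by blast
  ultimately show ?case
    using E(1,2) by (intro exI[of _ "insert w E"] conjI) simp_all
qed

lemma posdef_mat_diagonalisable:
  fixes A :: "complex^'d^'d"
  assumes A: "posdef_mat A"
  obtains U l where "unitary_mat U" "\<And>i. 0 < l i" "A = U ** diag_mat l ** adj_mat U"
proof -
  obtain E where E: "finite E" "card E = CARD('d)" "orthonormal E"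
    "\<forall>e\<in>E. \<exists>\<mu>>0. A *v e = \<mu> *\<^sub>R e"
    using posdef_orthonormal_eigenvectors[OF A order_refl] by blast
  obtain b where b: "bij_betw b (UNIV :: 'd set) E"
    using finite_same_card_bij[OF finite E(1)] E(2) by metis
  have bE: "b i \<in> E" and b_eq: "b i = b j \<longleftrightarrow> i = j" for i j
    using b by (auto simp: bij_betw_def inj_def)
  have "\<forall>i. \<exists>\<mu>. 0 < \<mu> \<and> A *v b i = \<mu> *\<^sub>R b i"
    using E(4) bE by blast
  then obtain l where l: "\<And>i. 0 < l i" "\<And>i. A *v b i = l i *\<^sub>R b i"
    by (metis choice)
  define U :: "complex^'d^'d" where "U = (\<chi> i j. b j $ i)"
  have "(adj_mat U ** U) $ i $ j = hinner (b i) (b j)" for i j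
    by (simp add: adj_mat_def U_def matrix_matrix_mult_def hinner_def)
  then have UU: "adj_mat U ** U = mat 1"
    using E(3) bE b_eq by (auto simp: vec_eq_iff orthonormal_def mat_def)
  then have UU': "U ** adj_mat U = mat 1"
    using matrix_left_right_inverse by blast
  have "(A ** U) $ i $ j = (A *v b j) $ i" for i j
    by (simp add: U_def matrix_matrix_mult_def matrix_vector_mult_def)
  then have "A ** U = U ** diag_mat l"
    by (simp add: vec_eq_iff mult_diag_mat_nth l)
       (simp add: U_def scaleR_conv_of_real mult.commute)
  then have "A ** (U ** adj_mat U) = U ** diag_mat l ** adj_mat U"
    by (simp add: matrix_mul_assoc)
  then have "A = U ** diag_mat l ** adj_mat U"
    by (simp add: UU')
  moreover have "unitary_mat U"
    using UU UU' by (simp add: unitary_mat_def)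
  ultimately show thesis
    using that l(1) by blast
qed

section \<open>Real powers of a positive definite matrix\<close>

lemma posdef_mat_powr_diagonalisable:
  fixes A :: "complex^'d^'d"
  assumes "posdef_mat A"
  obtains U l where "unitary_mat U" "\<And>i. 0 < l i"
    "\<And>s. mat_powr A s = U ** diag_mat (\<lambda>i. l i powr s) ** adj_mat U"
proof -
  obtain U l where U: "unitary_mat U" "\<And>i. 0 < l i" and A: "A = U ** diag_mat l ** adj_mat U"
    using posdef_mat_diagonalisable[OF assms] by blast
  have "mat_powr A s = U ** diag_mat (\<lambda>i. l i powr s) ** adj_mat U" for s
    unfolding A by (rule mat_powr_diagonalised[OF U])
  then show thesis
    using that U by blast
qed

lemma mat_powr_add:
  fixes A :: "complex^'d^'d"
  assumes "posdef_mat A"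
  shows "mat_powr A s ** mat_powr A t = mat_powr A (s + t)"
proof -
  obtain U l where U: "unitary_mat U" and l: "\<And>i. 0 < l i"
    and A: "\<And>s. mat_powr A s = U ** diag_mat (\<lambda>i. l i powr s) ** adj_mat U"
    using posdef_mat_powr_diagonalisable[OF assms] by blast
  have "mat_powr A s ** mat_powr A t
      = U ** diag_mat (\<lambda>i. l i powr s) ** (adj_mat U ** U) ** diag_mat (\<lambda>i. l i powr t) ** adj_mat U"
    by (simp only: A matrix_mul_assoc)
  also have "\<dots> = U ** (diag_mat (\<lambda>i. l i powr s) ** diag_mat (\<lambda>i. l i powr t)) ** adj_mat U"
    using U by (simp add: unitary_mat_def matrix_mul_assoc)
  also have "\<dots> = mat_powr A (s + t)"
    by (simp add: diag_mat_mult A powr_add)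
  finally show ?thesis .
qed

lemma mat_powr_0:
  fixes A :: "complex^'d^'d"
  assumes "posdef_mat A"
  shows "mat_powr A 0 = mat 1"
proof -
  obtain U l where U: "unitary_mat U" and l: "\<And>i. 0 < l i"
    and A: "\<And>s. mat_powr A s = U ** diag_mat (\<lambda>i. l i powr s) ** adj_mat U"
    using posdef_mat_powr_diagonalisable[OF assms] by blast
  have "(\<lambda>i. l i powr 0) = (\<lambda>i. 1)"
    using l by (simp add: fun_eq_iff less_imp_neq[symmetric])
  then show ?thesis
    using U by (simp add: A unitary_mat_def)
qed

lemma adj_mat_mat_powr:
  fixes A :: "complex^'d^'d"
  assumes "posdef_mat A"
  shows "adj_mat (mat_powr A s) = mat_powr A s"
proof -
  obtain U l where "unitary_mat U" "\<And>i. 0 < l i"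
    and A: "\<And>s. mat_powr A s = U ** diag_mat (\<lambda>i. l i powr s) ** adj_mat U"
    using posdef_mat_powr_diagonalisable[OF assms] by blast
  show ?thesis unfolding A
    by (simp add: adj_mat_mult matrix_mul_assoc)
qed

section \<open>The spectral norm\<close>

lemma norm_matrix_vector_le: "norm (A *v v) \<le> spectral_norm A * norm v"
  unfolding spectral_norm_def by (rule onorm) simp

lemma spectral_norm_nonneg: "0 \<le> spectral_norm A"
  unfolding spectral_norm_def by (rule onorm_pos_le) simp

lemma spectral_norm_le:
  assumes "\<And>v. norm (A *v v) \<le> c * norm v"
  shows "spectral_norm A \<le> c"
  unfolding spectral_norm_def using assms by (rule onorm_le)

lemma spectral_norm_mult_le: "spectral_norm (A ** B) \<le> spectral_norm A * spectral_norm B"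
proof (rule spectral_norm_le)
  fix v
  have "norm ((A ** B) *v v) \<le> spectral_norm A * norm (B *v v)"
    by (simp add: norm_matrix_vector_le flip: matrix_vector_mul_assoc)
  also have "\<dots> \<le> spectral_norm A * (spectral_norm B * norm v)"
    by (intro mult_left_mono norm_matrix_vector_le spectral_norm_nonneg)
  finally show "norm ((A ** B) *v v) \<le> spectral_norm A * spectral_norm B * norm v"
    by simp
qed

lemma spectral_norm_mat_1: "spectral_norm (mat 1 :: complex^'d^'d) = 1"
proof -
  have "onorm (\<lambda>v::complex^'d. mat 1 *v v) = onorm (\<lambda>v::complex^'d. v)"
    by simp
  also have "\<dots> = 1"
    by (rule onorm_id)
  finally show ?thesis
    by (simp add: spectral_norm_def)
qed

lemma spectral_norm_adj_le: "spectral_norm (adj_mat A) \<le> spectral_norm A"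
proof (rule spectral_norm_le)
  fix v
  define w where "w = adj_mat A *v v"
  have "norm w * norm w = inner (A *v w) v"
    by (simp add: w_def inner_matrix_mult_right inner_commute flip: power2_norm_eq_inner power2_eq_square)
  also have "\<dots> \<le> norm (A *v w) * norm v"
    by (rule norm_cauchy_schwarz)
  also have "\<dots> \<le> spectral_norm A * norm w * norm v"
    by (intro mult_right_mono norm_matrix_vector_le) simp
  finally have "norm w * norm w \<le> (spectral_norm A * norm v) * norm w"
    by (simp add: ac_simps)
  then show "norm (adj_mat A *v v) \<le> spectral_norm A * norm v"
    using spectral_norm_nonneg[of A] unfolding w_def[symmetric]
    by (cases "norm w = 0") auto
qed

lemma spectral_norm_adj [simp]: "spectral_norm (adj_mat A) = spectral_norm A"
  using spectral_norm_adj_le[of A] spectral_norm_adj_le[of "adj_mat A"] by simp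

lemma spectral_norm_le_entries: "spectral_norm A \<le> (\<Sum>i\<in>UNIV. \<Sum>j\<in>UNIV. norm (A $ i $ j))"
proof (rule spectral_norm_le)
  fix v
  have "norm (A *v v) \<le> (\<Sum>i\<in>UNIV. norm ((A *v v) $ i))"
    unfolding norm_vec_def by (rule L2_set_le_sum) simp
  also have "\<dots> \<le> (\<Sum>i\<in>UNIV. \<Sum>j\<in>UNIV. norm (A $ i $ j) * norm v)"
  proof (rule sum_mono)
    fix i
    have "norm ((A *v v) $ i) \<le> (\<Sum>j\<in>UNIV. norm (A $ i $ j * v $ j))"
      unfolding matrix_vector_mult_def by (simp add: norm_sum)
    also have "\<dots> \<le> (\<Sum>j\<in>UNIV. norm (A $ i $ j) * norm v)"
      unfolding norm_mult by (intro sum_mono mult_left_mono Finite_Cartesian_Product.norm_nth_le) auto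
    finally show "norm ((A *v v) $ i) \<le> (\<Sum>j\<in>UNIV. norm (A $ i $ j) * norm v)" .
  qed
  finally show "norm (A *v v) \<le> (\<Sum>i\<in>UNIV. \<Sum>j\<in>UNIV. norm (A $ i $ j)) * norm v"
    by (simp add: sum_distrib_right)
qed

lemma spectral_norm_unitary_conj:
  assumes "unitary_mat U" "unitary_mat V"
  shows "spectral_norm (U ** A ** adj_mat V) \<le> spectral_norm A"
proof (rule spectral_norm_le)
  fix v
  have "norm ((U ** A ** adj_mat V) *v v) = norm (A *v (adj_mat V *v v))"
    using assms by (simp add: unitary_mat_norm flip: matrix_vector_mul_assoc)
  also have "\<dots> \<le> spectral_norm A * norm v"
    using norm_matrix_vector_le[of A "adj_mat V *v v"] unitary_mat_adj[OF assms(2)]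
    by (simp add: unitary_mat_norm)
  finally show "norm ((U ** A ** adj_mat V) *v v) \<le> spectral_norm A * norm v" .
qed

section \<open>The Cordes inequality\<close>

text \<open>The boundedness needed to pass from midpoint convexity to convexity.\<close>

lemma mat_powr_bounded_interval:
  fixes A :: "complex^'d^'d"
  assumes "posdef_mat A"
  obtains C where "\<And>s. \<bar>s\<bar> \<le> u \<Longrightarrow> spectral_norm (mat_powr A s) \<le> C"
proof -
  obtain U l where U: "unitary_mat U" and l: "\<And>i. 0 < l i"
    and A: "\<And>s. mat_powr A s = U ** diag_mat (\<lambda>i. l i powr s) ** adj_mat U"
    using posdef_mat_powr_diagonalisable[OF assms] by blast
  have powr: "x powr s \<le> x powr u + x powr - u" if "\<bar>s\<bar> \<le> u" "0 < x" for x s :: real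
  proof (cases "x \<ge> 1")
    case True
    then have "x powr s \<le> x powr u" using that by (intro powr_mono) auto
    then show ?thesis by (simp add: add_increasing2)
  next
    case False
    then have "x powr s \<le> x powr - u" using that by (intro powr_mono') auto
    then show ?thesis by (simp add: add_increasing)
  qed
  have "spectral_norm (mat_powr A s)
      \<le> (\<Sum>i\<in>UNIV. \<Sum>j\<in>(UNIV::'d set). l i powr u + l i powr - u)" if "\<bar>s\<bar> \<le> u" for s
  proof -
    have "spectral_norm (mat_powr A s) \<le> spectral_norm (diag_mat (\<lambda>i. l i powr s) :: complex^'d^'d)"
      unfolding A by (rule spectral_norm_unitary_conj[OF U U])
    also have "\<dots> \<le> (\<Sum>i\<in>UNIV. \<Sum>j\<in>UNIV. norm ((diag_mat (\<lambda>i. l i powr s) :: complex^'d^'d) $ i $ j))"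
      by (rule spectral_norm_le_entries)
    also have "\<dots> \<le> (\<Sum>i\<in>UNIV. \<Sum>j\<in>(UNIV::'d set). l i powr u + l i powr - u)"
      using powr[OF that l] by (intro sum_mono) (auto simp: diag_mat_def)
    finally show ?thesis .
  qed
  then show thesis
    using that by blast
qed

text \<open>If \<open>v\<close> is a maximal singular vector of \<open>A\<^sup>m B\<^sup>-\<^sup>m\<close>, where
  \<open>m = (a + b)/2\<close>, then \<open>w = B\<^sup>m\<^sup>-\<^sup>a v\<close> is an eigenvector of
  \<open>B\<^sup>-\<^sup>a A\<^sup>a\<^sup>+\<^sup>b B\<^sup>-\<^sup>b\<close> for the squared singular value: this is the
  invariance of the spectrum of a product under cyclic permutation. The norm of the latter product
  splits into the two factors on the right.\<close>

lemma spectral_norm_powr_midpoint: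
  fixes A B :: "complex^'d^'d"
  assumes A: "posdef_mat A" and B: "posdef_mat B"
  shows "(spectral_norm (mat_powr A ((a + b)/2) ** mat_powr B (- ((a + b)/2))))\<^sup>2
    \<le> spectral_norm (mat_powr A a ** mat_powr B (- a)) * spectral_norm (mat_powr A b ** mat_powr B (- b))"
proof -
  define m where "m = (a + b)/2"
  define T where "T = mat_powr A m ** mat_powr B (- m)"
  have adjT: "adj_mat T = mat_powr B (- m) ** mat_powr A m"
    by (simp add: T_def adj_mat_mult adj_mat_mat_powr A B)
  obtain v \<sigma> where v: "norm v = 1" "0 \<le> \<sigma>" "adj_mat T *v (T *v v) = \<sigma>\<^sup>2 *\<^sub>R v"
    and bound: "\<And>u. norm (T *v u) \<le> \<sigma> * norm u"
  proof (rule maximal_singular_vector[of "(*v) T" "(*v) (adj_mat T)" UNIV])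
    show "linear ((*v) T)"
      using matrix_vector_mul_bounded_linear[of T] by (simp add: bounded_linear.linear)
    show "inner (T *v x) y = inner x (adj_mat T *v y)" for x y
      by (simp add: inner_matrix_mult_right)
    show "\<exists>x::complex^'d\<in>UNIV. x \<noteq> 0"
      by (rule bexI[of _ "axis undefined 1"]) (auto simp: axis_eq_0_iff)
  qed auto
  have T_le: "spectral_norm T \<le> \<sigma>"
    by (rule spectral_norm_le[OF bound])
  have mid: "mat_powr B (- m) ** mat_powr A (a + b) ** mat_powr B (- m) = adj_mat T ** T"
  proof -
    have "mat_powr A (a + b) = mat_powr A m ** mat_powr A m"
      by (simp add: mat_powr_add[OF A] m_def)
    then show ?thesis
      unfolding adjT by (simp add: T_def matrix_mul_assoc)
  qed
  define w where "w = mat_powr B (m - a) *v v"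
  define M where "M = mat_powr B (- a) ** mat_powr A (a + b) ** mat_powr B (- b)"
  have "M ** mat_powr B (m - a) = mat_powr B (- a) ** mat_powr A (a + b) ** mat_powr B (- m)"
  proof -
    have "- b + (m - a) = - m"
      by (simp add: m_def field_simps)
    then have "mat_powr B (- b) ** mat_powr B (m - a) = mat_powr B (- m)"
      by (simp only: mat_powr_add[OF B])
    then show ?thesis
      by (simp add: M_def flip: matrix_mul_assoc)
  qed
  also have "\<dots> = mat_powr B (m - a) ** (adj_mat T ** T)"
  proof -
    have "mat_powr B (- a) = mat_powr B (m - a) ** mat_powr B (- m)"
      by (simp add: mat_powr_add[OF B])
    then show ?thesis
      by (simp add: matrix_mul_assoc flip: mid)
  qed
  finally have "M *v w = mat_powr B (m - a) *v (\<sigma>\<^sup>2 *\<^sub>R v)"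
    using v(3) by (metis matrix_vector_mul_assoc w_def)
  then have Mw: "M *v w = \<sigma>\<^sup>2 *\<^sub>R w"
    using matrix_vector_mul_bounded_linear[of "mat_powr B (m - a)"]
    by (simp add: w_def linear_scale bounded_linear.linear)
  have "mat_powr B (a - m) *v w = v"
    by (simp add: w_def matrix_vector_mul_assoc mat_powr_add[OF B] mat_powr_0[OF B])
  then have "w \<noteq> 0"
    using v(1) by auto
  moreover have "\<sigma>\<^sup>2 * norm w \<le> spectral_norm M * norm w"
    using norm_matrix_vector_le[of M w] by (simp add: Mw)
  ultimately have "\<sigma>\<^sup>2 \<le> spectral_norm M"
    by simp
  also have "M = adj_mat (mat_powr A a ** mat_powr B (- a)) ** (mat_powr A b ** mat_powr B (- b))"
  proof -
    have "mat_powr A (a + b) = mat_powr A a ** mat_powr A b"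
      by (simp add: mat_powr_add[OF A])
    then show ?thesis
      by (simp add: M_def adj_mat_mult adj_mat_mat_powr A B matrix_mul_assoc)
  qed
  also have "spectral_norm \<dots> \<le> spectral_norm (mat_powr A a ** mat_powr B (- a))
      * spectral_norm (mat_powr A b ** mat_powr B (- b))"
    using spectral_norm_mult_le by (metis spectral_norm_adj)
  finally show ?thesis
    using power_mono[OF T_le spectral_norm_nonneg, of 2] by (simp add: T_def m_def)
qed

lemma spectral_norm_powr_pos:
  fixes A B :: "complex^'d^'d"
  assumes A: "posdef_mat A" and B: "posdef_mat B"
  shows "0 < spectral_norm (mat_powr A s ** mat_powr B t)"
proof -
  let ?T = "mat_powr A s ** mat_powr B t"
  have "mat_powr A (- s) ** ?T ** mat_powr B (- t)
      = (mat_powr A (- s) ** mat_powr A s) ** (mat_powr B t ** mat_powr B (- t))"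
    by (simp only: matrix_mul_assoc)
  also have "\<dots> = mat 1"
    by (simp add: mat_powr_add mat_powr_0 A B)
  finally have "1 = spectral_norm (mat_powr A (- s) ** ?T ** mat_powr B (- t))"
    by (simp add: spectral_norm_mat_1)
  also have "\<dots> \<le> spectral_norm (mat_powr A (- s)) * spectral_norm ?T * spectral_norm (mat_powr B (- t))"
    by (meson mult_right_mono order_trans spectral_norm_mult_le spectral_norm_nonneg)
  finally have "spectral_norm ?T \<noteq> 0"
    by auto
  then show ?thesis
    using spectral_norm_nonneg[of ?T] by linarith
qed

text \<open>A point of \<open>[0, 1]\<close> is the midpoint of an endpoint and another point of
  \<open>[0, 1]\<close>, so any upper bound \<open>M\<close> for \<open>g\<close> improves to \<open>M/2\<close>.
  Boundedness thus takes the place of continuity.\<close>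

lemma midpoint_convex_nonpos:
  fixes g :: "real \<Rightarrow> real"
  assumes mid: "\<And>a b. a \<in> {0..1} \<Longrightarrow> b \<in> {0..1} \<Longrightarrow> g ((a + b)/2) \<le> (g a + g b)/2"
    and bdd: "\<And>s. s \<in> {0..1} \<Longrightarrow> g s \<le> C"
    and "g 0 \<le> 0" "g 1 \<le> 0" and s: "s \<in> {0..1}"
  shows "g s \<le> 0"
proof -
  define M where "M = (SUP s\<in>{0..1}. g s)"
  have "bdd_above (g ` {0..1})"
    using bdd by (auto intro!: bdd_aboveI[of _ C])
  then have le_M: "g s \<le> M" if "s \<in> {0..1}" for s
    unfolding M_def using that by (rule cSUP_upper2) simp_all
  have "g s \<le> M/2" if s: "s \<in> {0..1}" for s
  proof (cases "s \<le> 1/2")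
    case True
    then show ?thesis
      using mid[of 0 "2 * s"] le_M[of "2 * s"] s \<open>g 0 \<le> 0\<close> by simp
  next
    case False
    then show ?thesis
      using mid[of "2 * s - 1" 1] le_M[of "2 * s - 1"] s \<open>g 1 \<le> 0\<close> by simp
  qed
  then have "M \<le> M/2"
    unfolding M_def by (intro cSUP_least) auto
  then show ?thesis
    using le_M[OF s] by simp
qed

text \<open>The excess of \<open>ln f\<close> over its linear interpolation between \<open>0\<close> and
  \<open>u\<close> is midpoint convex, bounded above, and vanishes at both ends.\<close>

theorem Cordes_inequality:
  fixes A B :: "complex^'d^'d"
  assumes A: "posdef_mat A" and B: "posdef_mat B" and s: "0 \<le> s" "s \<le> 1" and u: "0 \<le> u"
  shows "spectral_norm (mat_powr A (s * u) ** mat_powr B (- (s * u)))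
    \<le> spectral_norm (mat_powr A u ** mat_powr B (- u)) powr s"
proof -
  define f where "f t = spectral_norm (mat_powr A t ** mat_powr B (- t))" for t
  define g where "g t = ln (f (t * u)) - t * ln (f u)" for t
  have f_pos: "0 < f t" for t
    unfolding f_def by (rule spectral_norm_powr_pos[OF A B])
  have f0: "f 0 = 1"
    by (simp add: f_def mat_powr_0 A B spectral_norm_mat_1)
  have "ln (f ((a + b)/2)) \<le> (ln (f a) + ln (f b))/2" for a b
  proof -
    have "(f ((a + b)/2))\<^sup>2 \<le> f a * f b"
      unfolding f_def by (rule spectral_norm_powr_midpoint[OF A B])
    then have "ln ((f ((a + b)/2))\<^sup>2) \<le> ln (f a * f b)"
      using f_pos[of "(a + b)/2"] by (intro ln_mono) auto
    then show ?thesis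
      using f_pos[of "(a + b)/2"] f_pos[of a] f_pos[of b]
      by (simp add: ln_realpow ln_mult less_imp_neq[symmetric])
  qed
  from this[of "a * u" "b * u" for a b]
  have mid: "g ((a + b)/2) \<le> (g a + g b)/2" for a b
    by (simp add: g_def field_simps)
  obtain C D where C: "\<And>t. \<bar>t\<bar> \<le> u \<Longrightarrow> spectral_norm (mat_powr A t) \<le> C"
    and D: "\<And>t. \<bar>t\<bar> \<le> u \<Longrightarrow> spectral_norm (mat_powr B t) \<le> D"
    using mat_powr_bounded_interval[OF A] mat_powr_bounded_interval[OF B] by metis
  have bdd: "g t \<le> ln (C * D) + \<bar>ln (f u)\<bar>" if t: "t \<in> {0..1}" for t
  proof -
    have tu: "\<bar>t * u\<bar> \<le> u"
      using t u by (simp add: mult_left_le_one_le)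
    have "f (t * u) \<le> spectral_norm (mat_powr A (t * u)) * spectral_norm (mat_powr B (- (t * u)))"
      unfolding f_def by (rule spectral_norm_mult_le)
    also have "\<dots> \<le> C * D"
      using C[OF tu] D[of "- (t * u)"] tu by (intro mult_mono) (auto intro: spectral_norm_nonneg order_trans)
    finally have "ln (f (t * u)) \<le> ln (C * D)"
      using f_pos by (intro ln_mono) auto
    moreover have "\<bar>t * ln (f u)\<bar> \<le> \<bar>ln (f u)\<bar>"
      using t by (simp add: abs_mult mult_left_le_one_le)
    ultimately show ?thesis
      unfolding g_def by linarith
  qed
  have "g s \<le> 0"
    by (rule midpoint_convex_nonpos[OF mid bdd]) (use s in \<open>simp_all add: g_def f0\<close>)
  then have "ln (f (s * u)) \<le> ln (f u powr s)"
    using f_pos by (simp add: g_def ln_powr)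
  then have "f (s * u) \<le> f u powr s"
    using f_pos by (subst (asm) ln_le_cancel_iff) (auto simp: less_imp_neq[symmetric])
  then show ?thesis
    by (simp add: f_def)
qed

section \<open>Monotonicity of the weight characteristic\<close>

lemma ennreal_powr_mono:
  assumes "x \<le> y" "0 \<le> r"
  shows "ennreal_powr x r \<le> ennreal_powr y r"
proof (cases "y = \<infinity>")
  case False
  then have "y < top"
    by (simp add: less_top)
  moreover from this have "x \<noteq> \<infinity>"
    using assms by auto
  ultimately show ?thesis
    using assms False by (simp add: ennreal_powr_def powr_mono2 enn2real_mono)
qed (simp add: ennreal_powr_def)

lemma avg_mono_AE:
  assumes "AE x in lebesgue. x \<in> Q \<longrightarrow> f x \<le> g x"
  shows "avg Q f \<le> avg Q g"
  unfolding avg_def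
  by (intro divide_right_mono_ennreal nn_integral_mono_AE)
     (use assms in \<open>auto elim!: eventually_mono simp: indicator_def\<close>)

lemma conj_exp_gt_1: "1 < p \<Longrightarrow> 1 < conj_exp p"
  by (simp add: conj_exp_def)

lemma conj_exp_antimono: "1 < p \<Longrightarrow> p \<le> r \<Longrightarrow> conj_exp r \<le> conj_exp p"
  by (simp add: conj_exp_def field_simps)

text \<open>With \<open>s = q2 / q1\<close> one has \<open>s p1' = p2'\<close>, so raising the Cordes inequality to the
  power \<open>p1'\<close> compares the integrands pointwise, while the outer exponents agree.\<close>

lemma Apq_const_mono:
  fixes W :: "'a::euclidean_space \<Rightarrow> complex^'d^'d"
  assumes p: "1 < p1" "p1 \<le> q1" "1 < p2" "p2 \<le> q2" "p1 \<le> p2"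
    and eq: "q1 / conj_exp p1 = q2 / conj_exp p2"
    and W: "matrix_weight W"
  shows "Apq_const p1 q1 W \<le> Apq_const p2 q2 W"
proof -
  note c = conj_exp_gt_1[OF p(1)] conj_exp_gt_1[OF p(3)] conj_exp_antimono[OF p(1,5)]
  define s where "s = conj_exp p2 / conj_exp p1"
  have s: "0 \<le> s" "s \<le> 1" "s * (1/q2) = 1/q1" "s * conj_exp p1 = conj_exp p2"
    using c p eq by (auto simp: s_def field_simps)
  have AE: "AE x in lebesgue. posdef_mat (W x)"
    using W by (simp add: matrix_weight_def)
  have le: "spectral_norm (mat_powr (W x) (1/q1) ** mat_powr (W y) (- 1/q1)) powr conj_exp p1
      \<le> spectral_norm (mat_powr (W x) (1/q2) ** mat_powr (W y) (- 1/q2)) powr conj_exp p2"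
    if xy: "posdef_mat (W x)" "posdef_mat (W y)" for x y
  proof -
    have "spectral_norm (mat_powr (W x) (1/q1) ** mat_powr (W y) (- 1/q1))
        \<le> spectral_norm (mat_powr (W x) (1/q2) ** mat_powr (W y) (- 1/q2)) powr s"
      using Cordes_inequality[OF xy s(1,2), of "1/q2"] p unfolding s(3) by simp
    then have "spectral_norm (mat_powr (W x) (1/q1) ** mat_powr (W y) (- 1/q1)) powr conj_exp p1
        \<le> (spectral_norm (mat_powr (W x) (1/q2) ** mat_powr (W y) (- 1/q2)) powr s) powr conj_exp p1"
      using c by (intro powr_mono2 spectral_norm_nonneg) auto
    then show ?thesis
      by (simp add: powr_powr s(4))
  qed
  show ?thesis
    unfolding Apq_const_def eq
  proof (rule SUP_mono, rule bexI)
    fix Q :: "'a set"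
    show "avg Q (\<lambda>x. ennreal_powr (avg Q (\<lambda>y. ennreal (spectral_norm
            (mat_powr (W x) (1/q1) ** mat_powr (W y) (- 1/q1)) powr conj_exp p1))) (q2 / conj_exp p2))
        \<le> avg Q (\<lambda>x. ennreal_powr (avg Q (\<lambda>y. ennreal (spectral_norm
            (mat_powr (W x) (1/q2) ** mat_powr (W y) (- 1/q2)) powr conj_exp p2))) (q2 / conj_exp p2))"
    proof (rule avg_mono_AE, rule eventually_mono[OF AE], rule impI)
      fix x assume x: "posdef_mat (W x)"
      show "ennreal_powr (avg Q (\<lambda>y. ennreal (spectral_norm
            (mat_powr (W x) (1/q1) ** mat_powr (W y) (- 1/q1)) powr conj_exp p1))) (q2 / conj_exp p2)
        \<le> ennreal_powr (avg Q (\<lambda>y. ennreal (spectral_norm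
            (mat_powr (W x) (1/q2) ** mat_powr (W y) (- 1/q2)) powr conj_exp p2))) (q2 / conj_exp p2)"
      proof (rule ennreal_powr_mono, rule avg_mono_AE, rule eventually_mono[OF AE], rule impI)
        fix y assume "posdef_mat (W y)"
        then show "ennreal (spectral_norm
              (mat_powr (W x) (1/q1) ** mat_powr (W y) (- 1/q1)) powr conj_exp p1)
            \<le> ennreal (spectral_norm
              (mat_powr (W x) (1/q2) ** mat_powr (W y) (- 1/q2)) powr conj_exp p2)"
          by (intro ennreal_leI le x)
      qed (use p c in auto)
    qed
  qed
qed

section \<open>Averages over cubes\<close>

lemma emeasure_cube:
  assumes "Q \<in> cubes"
  shows "0 < emeasure lebesgue Q" "emeasure lebesgue Q < \<infinity>" "Q \<in> sets lebesgue"
proof -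
  obtain a :: 'a and r where Q: "Q = cbox a (a + r *\<^sub>R One)" and r: "0 < r"
    using assms by (auto simp: cubes_def)
  have "a \<bullet> b \<le> (a + r *\<^sub>R One) \<bullet> b" if "b \<in> Basis" for b
    using r that by (simp add: inner_add_left)
  then have "emeasure lebesgue Q = ennreal (\<Prod>b\<in>Basis. ((a + r *\<^sub>R One) - a) \<bullet> b)"
    unfolding Q by (simp add: emeasure_lborel_cbox del: inner_scaleR_left)
  also have "\<dots> = ennreal (r ^ DIM('a))"
    by simp
  finally show "0 < emeasure lebesgue Q" "emeasure lebesgue Q < \<infinity>"
    using r by simp_all
  show "Q \<in> sets lebesgue"
    by (simp add: Q)
qed

lemma avg_const:
  assumes "Q \<in> cubes"
  shows "avg Q (\<lambda>x. c) = c"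
  using emeasure_cube[OF assms]
  by (simp add: avg_def nn_integral_cmult_indicator ennreal_mult_divide_eq less_imp_neq[symmetric])

lemma avg_ge_on_subset:
  assumes "A \<in> sets lebesgue" "A \<subseteq> Q" "\<And>x. x \<in> A \<Longrightarrow> c \<le> f x"
  shows "c * emeasure lebesgue A / emeasure lebesgue Q \<le> avg Q f"
proof -
  have "c * emeasure lebesgue A = (\<integral>\<^sup>+x. c * indicator A x \<partial>lebesgue)"
    using assms(1) by (simp add: nn_integral_cmult_indicator)
  also have "\<dots> \<le> (\<integral>\<^sup>+x\<in>Q. f x \<partial>lebesgue)"
    using assms(2,3) by (intro nn_integral_mono) (auto simp: indicator_def)
  finally show ?thesis
    unfolding avg_def by (rule divide_right_mono_ennreal)
qed

lemma ennreal_mult_divide_ennreal: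
  assumes "0 \<le> a" "0 \<le> b" "0 < c"
  shows "ennreal a * ennreal b / ennreal c = ennreal (a * b / c)"
proof -
  have "ennreal a * ennreal b = ennreal (a * b)"
    using assms by (simp add: ennreal_mult)
  then show ?thesis
    using assms by (simp add: divide_ennreal)
qed

lemma avg_cmult:
  assumes "(\<lambda>x. f x * indicator Q x) \<in> borel_measurable lebesgue"
  shows "avg Q (\<lambda>x. c * f x) = c * avg Q f"
  using nn_integral_cmult[OF assms, of c]
  by (simp add: avg_def ennreal_times_divide mult.assoc)

lemma ennreal_powr_ennreal: "0 \<le> x \<Longrightarrow> ennreal_powr (ennreal x) r = ennreal (x powr r)"
  by (simp add: ennreal_powr_def)

lemma AE_lebesgue_nonzero: "AE x::real in lebesgue. x \<noteq> 0"
  by (intro AE_completion AE_lborel_singleton)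

lemma cube_real_cases:
  assumes "Q \<in> (cubes :: real set set)"
  obtains a h where "0 < h" "Q = {a..a + h}"
  using assms by (auto simp: cubes_def)

lemma inverse_sqrt_has_integral:
  assumes "0 \<le> M"
  shows "((\<lambda>x::real. \<bar>x\<bar> powr (-1/2)) has_integral 4 * M powr (1/2)) {-M..M}"
proof -
  have "((\<lambda>x. x powr (-1/2)) has_integral (M powr (-1/2 + 1) / (-1/2 + 1))) {0..M}"
    using assms by (intro has_integral_powr_from_0) auto
  then have "((\<lambda>x. x powr (-1/2)) has_integral 2 * M powr (1/2)) {0..M}"
    by (simp add: mult.commute)
  then have 1: "((\<lambda>x. \<bar>x\<bar> powr (-1/2)) has_integral 2 * M powr (1/2)) {0..M}"
    by (rule has_integral_eq[rotated]) auto
  then have 2: "((\<lambda>x. \<bar>x\<bar> powr (-1/2)) has_integral 2 * M powr (1/2)) {-M..0}"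
    using has_integral_reflect_real[of "\<lambda>x. \<bar>x\<bar> powr (-1/2)" "2 * M powr (1/2)" M 0] by simp
  show ?thesis
    using has_integral_combine[OF _ _ 2 1] assms by simp
qed

text \<open>An interval that is long compared with its largest absolute value \<open>M\<close> is covered by
  \<open>[-M, M]\<close> at the cost of a constant; on a short one \<open>|x|\<close> stays comparable to
  \<open>M\<close>.\<close>

lemma avg_inverse_sqrt_le:
  fixes a h :: real
  assumes h: "0 < h" and M: "M = max \<bar>a\<bar> \<bar>a + h\<bar>"
  shows "avg {a..a + h} (\<lambda>x. ennreal (M powr (1/2) * \<bar>x\<bar> powr (-1/2))) \<le> 8"
proof -
  have M0: "0 < M" and sub: "{a..a + h} \<subseteq> {-M..M}"
    using h by (auto simp: M)
  have Q: "{a..a + h} \<in> cubes"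
    using h by (auto simp: cubes_def intro!: exI[of _ a] exI[of _ h])
  show ?thesis
  proof (cases "h \<ge> M/2")
    case True
    have "(\<integral>\<^sup>+x\<in>{a..a + h}. ennreal (M powr (1/2) * \<bar>x\<bar> powr (-1/2)) \<partial>lebesgue)
        \<le> (\<integral>\<^sup>+x\<in>{-M..M}. ennreal (M powr (1/2) * \<bar>x\<bar> powr (-1/2)) \<partial>lebesgue)"
      using sub by (intro nn_integral_mono) (auto simp: indicator_def)
    also have "\<dots> = ennreal (M powr (1/2) * (4 * M powr (1/2)))"
      unfolding nn_integral_completion using M0
      by (intro nn_integral_has_integral_lebesgue' has_integral_mult_right inverse_sqrt_has_integral) auto
    also have "M powr (1/2) * (4 * M powr (1/2)) = 4 * M"
      using M0 by (simp add: powr_half_sqrt)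
    finally have "avg {a..a + h} (\<lambda>x. ennreal (M powr (1/2) * \<bar>x\<bar> powr (-1/2))) \<le> ennreal (4 * M) / ennreal h"
      unfolding avg_def using h by (simp add: divide_right_mono_ennreal)
    also have "\<dots> = ennreal (4 * M / h)"
      using M0 h by (simp add: divide_ennreal)
    also have "\<dots> \<le> ennreal 8"
      using True h by (intro ennreal_leI) (simp add: field_simps)
    finally show ?thesis by simp
  next
    case False
    have "M powr (1/2) * \<bar>x\<bar> powr (-1/2) \<le> 8" if "x \<in> {a..a + h}" for x
    proof -
      have x: "M/4 \<le> \<bar>x\<bar>"
        using that False M by (auto simp: max_def abs_if split: if_splits)
      then have "\<bar>x\<bar> powr (-1/2) \<le> (M/4) powr (-1/2)"
        using M0 by (intro powr_mono2') auto
      then have "M powr (1/2) * \<bar>x\<bar> powr (-1/2) \<le> M powr (1/2) * (M/4) powr (-1/2)"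
        by (intro mult_left_mono) auto
      also have "\<dots> = 2"
        using M0 by (simp add: powr_divide powr_minus_divide powr_half_sqrt)
      finally show ?thesis by simp
    qed
    then have "avg {a..a + h} (\<lambda>x. ennreal (M powr (1/2) * \<bar>x\<bar> powr (-1/2))) \<le> avg {a..a + h} (\<lambda>x. ennreal 8)"
      by (intro avg_mono_AE AE_I2 impI ennreal_leI)
    then show ?thesis
      by (simp add: avg_const[OF Q])
  qed
qed

section \<open>A weight with rotating eigenvectors\<close>

lemma posdef_mat_diagonalised:
  fixes U :: "complex^'d^'d"
  assumes U: "unitary_mat U" and l: "\<And>i. 0 < l i"
  shows "posdef_mat (U ** diag_mat l ** adj_mat U)"
  unfolding posdef_mat_def
proof (intro conjI allI impI)
  show "adj_mat (U ** diag_mat l ** adj_mat U) = U ** diag_mat l ** adj_mat U"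
    by (simp add: adj_mat_mult matrix_mul_assoc)
next
  fix v :: "complex^'d" assume "v \<noteq> 0"
  define w where "w = adj_mat U *v v"
  have "norm w \<noteq> 0"
    using \<open>v \<noteq> 0\<close> unitary_mat_norm[OF unitary_mat_adj[OF U]] by (simp add: w_def)
  then obtain k where "w $ k \<noteq> 0"
    by (auto simp: vec_eq_iff)
  have nonneg: "0 \<le> l i * (norm (w $ i))\<^sup>2" for i
    using l[of i] by simp
  have "0 < (\<Sum>i\<in>UNIV. l i * (norm (w $ i))\<^sup>2)"
    using \<open>w $ k \<noteq> 0\<close> l[of k] nonneg by (intro sum_pos2[of _ k]) auto
  also have "\<dots> = inner w (diag_mat l *v w)"
    by (simp add: inner_vec_def matrix_vector_mult_def diag_mat_def if_distrib if_distribR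
        scaleR_conv_of_real[symmetric] power2_norm_eq_inner cong: if_cong)
  also have "\<dots> = inner v ((U ** diag_mat l ** adj_mat U) *v v)"
    by (simp add: w_def inner_matrix_mult_right flip: matrix_vector_mul_assoc)
  finally show "0 < Re (\<Sum>i\<in>UNIV. cnj (v $ i) * ((U ** diag_mat l ** adj_mat U) *v v) $ i)"
    by (simp add: hinner_def flip: Re_hinner)
qed

text \<open>The rotation of the plane by the angle with sine \<open>s\<close> and nonnegative cosine.\<close>

definition rotation_mat :: "real \<Rightarrow> complex^2^2" where
  "rotation_mat s = (\<chi> i j. complex_of_real
     (if i = j then sqrt (1 - s\<^sup>2) else if i = 1 then - s else s))"

lemma unitary_rotation_mat:
  assumes "\<bar>s\<bar> \<le> 1"
  shows "unitary_mat (rotation_mat s)"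
proof -
  have "s\<^sup>2 \<le> 1"
    using assms by (simp add: abs_square_le_1)
  then have "complex_of_real (sqrt (1 - s\<^sup>2)) * complex_of_real (sqrt (1 - s\<^sup>2)) = 1 - (complex_of_real s)\<^sup>2"
    by (simp flip: of_real_mult)
  then have "adj_mat (rotation_mat s) ** rotation_mat s = mat 1"
    by (simp add: vec_eq_iff forall_2 matrix_matrix_mult_def sum_2 adj_mat_def rotation_mat_def
        mat_def power2_eq_square)
  then show ?thesis
    using matrix_left_right_inverse by (auto simp: unitary_mat_def)
qed

lemma rotation_mat_product_entries:
  defines "c \<equiv> \<lambda>s::real. sqrt (1 - s\<^sup>2)"
  shows "(adj_mat (rotation_mat s) ** rotation_mat t) $ i $ j
    = complex_of_real (if i = j then c s * c t + s * t else if i = 1 then s * c t - c s * t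
        else c s * t - s * c t)"
  using exhaust_2[of i] exhaust_2[of j]
  by (auto simp: matrix_matrix_mult_def sum_2 adj_mat_def rotation_mat_def c_def)

definition trunc_abs :: "real \<Rightarrow> real" where
  "trunc_abs x = min 1 \<bar>x\<bar>"

definition angle_sine :: "real \<Rightarrow> real \<Rightarrow> real" where
  "angle_sine \<kappa> x = (if x < 0 then 0 else trunc_abs x powr \<kappa>)"

definition weight_eigenvalue :: "real \<Rightarrow> 2 \<Rightarrow> real" where
  "weight_eigenvalue x i = (if i = 1 then trunc_abs x powr (-1/2) else 1)"

text \<open>Near the origin one eigenvalue blows up like \<open>|x|\<^bsup>-1/2\<^esup>\<close>. Its eigenvector is
  constant on the left and turned by the angle with sine \<open>x\<^sup>\<kappa>\<close> on the right; the
  choice of \<open>\<kappa>\<close> tunes the size of the interaction of the two eigenspaces. Because of the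
  truncation the second eigenvalue never exceeds the first, so the opposite mixed term stays
  bounded.\<close>

definition rotating_weight :: "real \<Rightarrow> real \<Rightarrow> complex^2^2" where
  "rotating_weight \<kappa> x = rotation_mat (angle_sine \<kappa> x) ** diag_mat (weight_eigenvalue x)
     ** adj_mat (rotation_mat (angle_sine \<kappa> x))"

lemma trunc_abs_bounds: "0 \<le> trunc_abs x" "trunc_abs x \<le> 1" "trunc_abs x \<le> \<bar>x\<bar>"
  by (auto simp: trunc_abs_def)

lemma trunc_abs_pos: "x \<noteq> 0 \<Longrightarrow> 0 < trunc_abs x"
  by (auto simp: trunc_abs_def)

lemma angle_sine_bounds:
  assumes "0 < \<kappa>"
  shows "0 \<le> angle_sine \<kappa> x" "angle_sine \<kappa> x \<le> 1" "angle_sine \<kappa> x \<le> trunc_abs x powr \<kappa>"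
  using assms trunc_abs_bounds[of x] by (auto simp: angle_sine_def powr_le1)

lemma unitary_angle_sine: "0 < \<kappa> \<Longrightarrow> unitary_mat (rotation_mat (angle_sine \<kappa> x))"
  by (intro unitary_rotation_mat) (simp add: angle_sine_bounds)

lemma weight_eigenvalue_pos: "x \<noteq> 0 \<Longrightarrow> 0 < weight_eigenvalue x i"
  using trunc_abs_pos[of x] by (simp add: weight_eigenvalue_def)

lemma mat_powr_rotating_weight:
  assumes "0 < \<kappa>" "x \<noteq> 0"
  shows "mat_powr (rotating_weight \<kappa> x) s = rotation_mat (angle_sine \<kappa> x)
    ** diag_mat (\<lambda>i. weight_eigenvalue x i powr s) ** adj_mat (rotation_mat (angle_sine \<kappa> x))"
  unfolding rotating_weight_def
  by (intro mat_powr_diagonalised unitary_angle_sine weight_eigenvalue_pos assms)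

text \<open>In the eigenbases of \<open>W x\<close> and \<open>W y\<close> the product \<open>(W x)\<^sup>s (W y)\<^sup>-\<^sup>s\<close>
  becomes the following explicit matrix.\<close>

definition weight_product_core :: "real \<Rightarrow> real \<Rightarrow> real \<Rightarrow> real \<Rightarrow> complex^2^2" where
  "weight_product_core \<kappa> s x y = diag_mat (\<lambda>i. weight_eigenvalue x i powr s)
     ** (adj_mat (rotation_mat (angle_sine \<kappa> x)) ** rotation_mat (angle_sine \<kappa> y))
     ** diag_mat (\<lambda>i. weight_eigenvalue y i powr - s)"

lemma spectral_norm_weight_product:
  assumes "0 < \<kappa>" "x \<noteq> 0" "y \<noteq> 0"
  shows "spectral_norm (mat_powr (rotating_weight \<kappa> x) s ** mat_powr (rotating_weight \<kappa> y) (- s))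
    = spectral_norm (weight_product_core \<kappa> s x y)"
proof -
  let ?U = "rotation_mat (angle_sine \<kappa> x)" and ?V = "rotation_mat (angle_sine \<kappa> y)"
  let ?P = "mat_powr (rotating_weight \<kappa> x) s ** mat_powr (rotating_weight \<kappa> y) (- s)"
  have U: "unitary_mat ?U" and V: "unitary_mat ?V"
    using unitary_angle_sine assms(1) by auto
  have P: "?P = ?U ** weight_product_core \<kappa> s x y ** adj_mat ?V"
    using assms by (simp add: mat_powr_rotating_weight weight_product_core_def matrix_mul_assoc)
  have "adj_mat ?U ** ?P ** adj_mat (adj_mat ?V)
      = (adj_mat ?U ** ?U) ** weight_product_core \<kappa> s x y ** (adj_mat ?V ** ?V)"
    by (simp add: P matrix_mul_assoc)
  then have core: "adj_mat ?U ** ?P ** adj_mat (adj_mat ?V) = weight_product_core \<kappa> s x y"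
    using U V by (simp add: unitary_mat_def)
  show ?thesis
  proof (rule antisym)
    show "spectral_norm ?P \<le> spectral_norm (weight_product_core \<kappa> s x y)"
      unfolding P by (rule spectral_norm_unitary_conj[OF U V])
    show "spectral_norm (weight_product_core \<kappa> s x y) \<le> spectral_norm ?P"
      using spectral_norm_unitary_conj[OF unitary_mat_adj[OF U] unitary_mat_adj[OF V], of ?P]
      by (simp only: core)
  qed
qed

lemma weight_product_core_entry:
  "norm (weight_product_core \<kappa> s x y $ i $ j) = weight_eigenvalue x i powr s
    * norm ((adj_mat (rotation_mat (angle_sine \<kappa> x)) ** rotation_mat (angle_sine \<kappa> y)) $ i $ j)
    * weight_eigenvalue y j powr - s"
  by (simp add: weight_product_core_def diag_mat_mult_nth mult_diag_mat_nth norm_mult)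

lemma norm_entry_le_spectral_norm: "norm (A $ i $ j) \<le> spectral_norm A"
  for A :: "complex^'d^'d"
proof -
  have "A $ i $ j = (A *v axis j 1) $ i"
    by (simp add: matrix_vector_mult_def axis_def if_distrib cong: if_cong)
  also have "norm \<dots> \<le> norm (A *v axis j 1)"
    by (rule Finite_Cartesian_Product.norm_nth_le)
  also have "\<dots> \<le> spectral_norm A"
    using norm_matrix_vector_le[of A "axis j 1"] by (simp add: norm_axis_1)
  finally show ?thesis .
qed

text \<open>The off-diagonal entries are, up to sign, the sine of the difference of the two angles; bounding them
  by the sum of the sines suffices.\<close>

lemma rotation_entry_bounds:
  assumes "0 \<le> s" "s \<le> 1" "0 \<le> t" "t \<le> 1"
  shows "norm ((adj_mat (rotation_mat s) ** rotation_mat t) $ i $ j) \<le> 2"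
    and "i \<noteq> j \<Longrightarrow> norm ((adj_mat (rotation_mat s) ** rotation_mat t) $ i $ j) \<le> s + t"
proof -
  define c where "c r = sqrt (1 - r\<^sup>2)" for r :: real
  have c: "0 \<le> c s" "c s \<le> 1" "0 \<le> c t" "c t \<le> 1"
    using assms by (auto simp: c_def power_le_one)
  have prods: "0 \<le> c s * c t" "c s * c t \<le> 1" "0 \<le> s * t" "s * t \<le> 1"
    "0 \<le> s * c t" "s * c t \<le> s" "0 \<le> c s * t" "c s * t \<le> t"
    using c assms by (auto intro: mult_le_one mult_left_le mult_left_le_one_le)
  have diag: "\<bar>c s * c t + s * t\<bar> \<le> 2"
    using prods by (intro abs_leI; linarith)
  have offdiag: "\<bar>s * c t - c s * t\<bar> \<le> s + t" "\<bar>c s * t - s * c t\<bar> \<le> s + t"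
    using prods assms by (intro abs_leI; linarith)+
  show "norm ((adj_mat (rotation_mat s) ** rotation_mat t) $ i $ j) \<le> 2"
    unfolding rotation_mat_product_entries norm_of_real c_def[symmetric]
    using diag offdiag assms by simp
  show "norm ((adj_mat (rotation_mat s) ** rotation_mat t) $ i $ j) \<le> s + t" if "i \<noteq> j"
    unfolding rotation_mat_product_entries norm_of_real c_def[symmetric]
    using offdiag that by simp
qed

text \<open>With \<open>s = 2 \<kappa>\<close> the large factor \<open>|x|\<^sup>-\<^sup>\<kappa>\<close> meets an off-diagonal entry
  of size at most \<open>|x|\<^sup>\<kappa> + |y|\<^sup>\<kappa>\<close>, so up to constants the mixed term is no worse than
  the scalar quotient \<open>(|y|/|x|)\<^sup>\<kappa>\<close> of the first eigenvalues.\<close>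

lemma weight_product_core_upper:
  assumes \<kappa>: "0 < \<kappa>" and x: "x \<noteq> 0" and y: "y \<noteq> 0" and M: "\<bar>x\<bar> \<le> M" "\<bar>y\<bar> \<le> M"
  shows "spectral_norm (weight_product_core \<kappa> (2 * \<kappa>) x y) \<le> 8 * (M / \<bar>x\<bar>) powr \<kappa>"
proof -
  define u v where "u = trunc_abs x" and "v = trunc_abs y"
  define B where "B = (M / \<bar>x\<bar>) powr \<kappa>"
  define R where "R = adj_mat (rotation_mat (angle_sine \<kappa> x)) ** rotation_mat (angle_sine \<kappa> y)"
  have u: "0 < u" "u \<le> 1" and v: "0 < v" "v \<le> 1"
    using x y trunc_abs_pos trunc_abs_bounds by (auto simp: u_def v_def)
  have "v / u \<le> M / \<bar>x\<bar>"
  proof (cases "1 \<le> \<bar>x\<bar>")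
    case True
    then have "v / u = v" and "1 \<le> M / \<bar>x\<bar>"
      using M by (auto simp: u_def trunc_abs_def field_simps)
    then show ?thesis
      using v by simp
  next
    case False
    moreover have "v \<le> M"
      using trunc_abs_bounds(3)[of y] M by (simp add: v_def)
    ultimately show ?thesis
      using x by (simp add: u_def trunc_abs_def divide_right_mono)
  qed
  then have ratio: "u powr - \<kappa> * v powr \<kappa> \<le> B"
    using u v \<kappa> by (simp add: B_def powr_minus_divide powr_mono2 flip: powr_divide)
  have B1: "1 \<le> B"
    using x M \<kappa> by (simp add: B_def ge_one_powr_ge_zero)
  have R: "norm (R $ i $ j) \<le> 2" for i j
    unfolding R_def using \<kappa> by (intro rotation_entry_bounds angle_sine_bounds)
  have R12: "norm (R $ 1 $ 2) \<le> u powr \<kappa> + v powr \<kappa>"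
  proof -
    have "norm (R $ 1 $ 2) \<le> angle_sine \<kappa> x + angle_sine \<kappa> y"
      unfolding R_def by (rule rotation_entry_bounds(2)) (simp_all add: angle_sine_bounds \<kappa>)
    then show ?thesis
      using angle_sine_bounds(3)[OF \<kappa>, of x] angle_sine_bounds(3)[OF \<kappa>, of y]
      by (simp add: u_def v_def)
  qed
  have entry: "norm (weight_product_core \<kappa> (2 * \<kappa>) x y $ i $ j)
      = (if i = 1 then u powr - \<kappa> else 1) * norm (R $ i $ j) * (if j = 1 then v powr \<kappa> else 1)" for i j
    unfolding weight_product_core_entry R_def[symmetric] weight_eigenvalue_def
    by (simp add: powr_powr u_def v_def)
  \<comment> \<open>Each of the four entries is at most \<open>2 B\<close>, whence the constant \<open>8\<close>.\<close>
  have 11: "norm (weight_product_core \<kappa> (2 * \<kappa>) x y $ 1 $ 1) \<le> 2 * B"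
  proof -
    have "u powr - \<kappa> * norm (R $ 1 $ 1) * v powr \<kappa> \<le> u powr - \<kappa> * 2 * v powr \<kappa>"
      by (intro mult_right_mono mult_left_mono R) auto
    then show ?thesis
      using ratio by (simp add: entry)
  qed
  have 12: "norm (weight_product_core \<kappa> (2 * \<kappa>) x y $ 1 $ 2) \<le> 2 * B"
  proof -
    have "u powr - \<kappa> * norm (R $ 1 $ 2) \<le> u powr - \<kappa> * (u powr \<kappa> + v powr \<kappa>)"
      by (intro mult_left_mono R12) auto
    also have "\<dots> = 1 + u powr - \<kappa> * v powr \<kappa>"
      using u by (simp add: distrib_left flip: powr_add)
    finally show ?thesis
      using ratio B1 by (simp add: entry)
  qed
  have 21: "norm (weight_product_core \<kappa> (2 * \<kappa>) x y $ 2 $ 1) \<le> 2 * B"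
  proof -
    have "norm (R $ 2 $ 1) * v powr \<kappa> \<le> 2 * 1"
      using v \<kappa> by (intro mult_mono R powr_le1) auto
    then show ?thesis
      using B1 by (simp add: entry)
  qed
  have 22: "norm (weight_product_core \<kappa> (2 * \<kappa>) x y $ 2 $ 2) \<le> 2 * B"
    using R[of 2 2] B1 by (simp add: entry)
  have "spectral_norm (weight_product_core \<kappa> (2 * \<kappa>) x y)
      \<le> (\<Sum>i\<in>UNIV. \<Sum>j\<in>UNIV. norm (weight_product_core \<kappa> (2 * \<kappa>) x y $ i $ j))"
    by (rule spectral_norm_le_entries)
  also have "\<dots> \<le> 8 * B"
    using 11 12 21 22 by (simp add: sum_2)
  finally show ?thesis
    by (simp add: B_def)
qed

text \<open>To the left of the origin the first eigenvector is the first unit vector, so its inner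
  product with the second eigenvector at \<open>y\<close> is, up to sign, the sine of the angle at
  \<open>y\<close>.\<close>

lemma weight_product_core_lower:
  assumes "0 < \<kappa>" "x < 0" "0 < y"
  shows "trunc_abs x powr (- s/2) * trunc_abs y powr \<kappa> \<le> spectral_norm (weight_product_core \<kappa> s x y)"
proof -
  have "norm (weight_product_core \<kappa> s x y $ 1 $ 2) = trunc_abs x powr (- s/2) * trunc_abs y powr \<kappa>"
    unfolding weight_product_core_entry rotation_mat_product_entries
    using assms by (simp add: weight_eigenvalue_def angle_sine_def powr_powr)
  then show ?thesis
    using norm_entry_le_spectral_norm by metis
qed

lemma matrix_weight_rotating_weight:
  assumes "0 < \<kappa>"
  shows "matrix_weight (rotating_weight \<kappa>)"
  unfolding matrix_weight_def
proof (intro conjI allI impI)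
  show "AE x in lebesgue. posdef_mat (rotating_weight \<kappa> x)"
    using AE_lebesgue_nonzero unfolding rotating_weight_def
    by eventually_elim (intro posdef_mat_diagonalised unitary_angle_sine weight_eigenvalue_pos assms)
next
  fix K :: "real set" assume K: "compact K"
  obtain M where M: "0 < M" "K \<subseteq> {-M..M}"
  proof -
    obtain b where "0 < b" "\<forall>x\<in>K. norm x \<le> b"
      using compact_imp_bounded[OF K] bounded_pos by blast
    then show thesis
      by (intro that[of b]) (auto simp: abs_le_iff minus_le_iff)
  qed
  define r :: "real \<Rightarrow> 2 \<Rightarrow> 2 \<Rightarrow> real" where
    "r s i j = (if i = j then sqrt (1 - s\<^sup>2) else if i = 1 then - s else s)" for s i j
  define w where "w i j x = (\<Sum>k\<in>UNIV. r (angle_sine \<kappa> x) i k * weight_eigenvalue x k * r (angle_sine \<kappa> x) j k)"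
    for i j x
  have "rotating_weight \<kappa> x $ i $ j = complex_of_real (w i j x)" for i j x
  proof -
    have R: "rotation_mat s $ i $ j = complex_of_real (r s i j)" for s i j
      by (simp add: rotation_mat_def r_def)
    have "rotating_weight \<kappa> x $ i $ j = (\<Sum>k\<in>UNIV.
        (rotation_mat (angle_sine \<kappa> x) ** diag_mat (weight_eigenvalue x)) $ i $ k
        * cnj (rotation_mat (angle_sine \<kappa> x) $ j $ k))"
      unfolding rotating_weight_def matrix_matrix_mult_def[of "_ ** _"] by (simp add: adj_mat_def)
    then show ?thesis
      by (simp add: mult_diag_mat_nth R w_def)
  qed
  then have W: "rotating_weight \<kappa> = (\<lambda>x. \<Sum>i\<in>UNIV. \<Sum>j\<in>UNIV. w i j x *\<^sub>R axis i (axis j 1))"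
    by (auto simp: fun_eq_iff vec_eq_iff forall_2 sum_2 axis_def of_real_def)
  have r_le: "\<bar>r (angle_sine \<kappa> x) i j\<bar> \<le> 1" for x i j
    using angle_sine_bounds[OF assms, of x] by (auto simp: r_def power_le_one)
  have w_le: "norm (w i j x) \<le> 2 + \<bar>x\<bar> powr (-1/2)" for i j x
  proof -
    have "norm (w i j x) \<le> (\<Sum>k\<in>UNIV. \<bar>r (angle_sine \<kappa> x) i k * weight_eigenvalue x k * r (angle_sine \<kappa> x) j k\<bar>)"
      unfolding w_def real_norm_def by (rule sum_abs)
    also have "\<dots> \<le> (\<Sum>k\<in>UNIV. 1 * \<bar>weight_eigenvalue x k\<bar> * 1)"
      unfolding abs_mult by (intro sum_mono mult_mono r_le) auto
    also have "\<dots> \<le> 2 + \<bar>x\<bar> powr (-1/2)"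
      by (auto simp: sum_2 weight_eigenvalue_def trunc_abs_def min_def)
    finally show ?thesis .
  qed
  have "w i j absolutely_integrable_on {-M..M}" for i j
  proof (rule measurable_bounded_by_integrable_imp_absolutely_integrable)
    have "w i j \<in> borel_measurable borel"
      unfolding w_def r_def weight_eigenvalue_def angle_sine_def trunc_abs_def by measurable
    then show "w i j \<in> borel_measurable (lebesgue_on {-M..M})"
      by (intro measurable_restrict_space1 measurable_completion) simp
    show "(\<lambda>x. 2 + \<bar>x\<bar> powr (-1/2)) integrable_on {-M..M}"
      using inverse_sqrt_has_integral[of M] M(1)
      by (intro integrable_add integrable_const_ivl) (auto intro: has_integral_integrable)
  qed (use w_le in auto)
  then have "w i j absolutely_integrable_on K" for i j
    by (rule set_integrable_subset) (use K M(2) in \<open>auto simp: compact_imp_closed\<close>)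
  then show "rotating_weight \<kappa> absolutely_integrable_on K"
    unfolding W by (intro absolutely_integrable_sum absolutely_integrable_scaleR_right) auto
qed

text \<open>When \<open>\<kappa> = 1/(2 q)\<close>, the upper bound reduces the matrix characteristic to averages of
  \<open>|x|\<^sup>-\<^sup>1\<^sup>/\<^sup>2\<close>.\<close>

lemma Apq_const_rotating_weight_finite:
  assumes p: "1 < p" and q: "0 < q"
  shows "Apq_const p q (rotating_weight (1 / (2 * q))) < \<infinity>"
proof -
  define \<kappa> where "\<kappa> = 1 / (2 * q)"
  define c where "c = conj_exp p"
  let ?N = "\<lambda>x y. spectral_norm (mat_powr (rotating_weight \<kappa> x) (1/q) ** mat_powr (rotating_weight \<kappa> y) (- 1/q))"
  have \<kappa>: "0 < \<kappa>" "2 * \<kappa> = 1/q" "\<kappa> * q = 1/2" and c: "1 < c"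
    using p q conj_exp_gt_1 by (auto simp: \<kappa>_def c_def)
  have "avg Q (\<lambda>x. ennreal_powr (avg Q (\<lambda>y. ennreal (?N x y powr c))) (q / c)) \<le> ennreal (8 powr q) * 8"
    if cube: "Q \<in> cubes" for Q
  proof -
    obtain a h where h: "0 < h" and Q: "Q = {a..a + h}"
      using cube_real_cases[OF cube] by blast
    define M where "M = max \<bar>a\<bar> \<bar>a + h\<bar>"
    have M: "\<bar>x\<bar> \<le> M" if "x \<in> Q" for x
      using that by (auto simp: Q M_def)
    have "0 < M"
      using h by (auto simp: M_def)
    have "avg Q (\<lambda>x. ennreal_powr (avg Q (\<lambda>y. ennreal (?N x y powr c))) (q / c))
        \<le> avg Q (\<lambda>x. ennreal (8 powr q) * ennreal (M powr (1/2) * \<bar>x\<bar> powr (-1/2)))"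
    proof (rule avg_mono_AE, rule eventually_mono[OF AE_lebesgue_nonzero], rule impI)
      fix x assume x: "x \<noteq> 0" "x \<in> Q"
      define B where "B = 8 * (M / \<bar>x\<bar>) powr \<kappa>"
      have B: "0 \<le> B"
        by (simp add: B_def)
      have "avg Q (\<lambda>y. ennreal (?N x y powr c)) \<le> avg Q (\<lambda>y. ennreal (B powr c))"
      proof (rule avg_mono_AE, rule eventually_mono[OF AE_lebesgue_nonzero], rule impI)
        fix y assume y: "y \<noteq> 0" "y \<in> Q"
        have "?N x y = spectral_norm (weight_product_core \<kappa> (2 * \<kappa>) x y)"
          using spectral_norm_weight_product[OF \<kappa>(1) x(1) y(1), of "1/q"] by (simp add: \<kappa>(2))
        also have "\<dots> \<le> B"
          unfolding B_def by (intro weight_product_core_upper \<kappa> x y M)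
        finally show "ennreal (?N x y powr c) \<le> ennreal (B powr c)"
          using c by (intro ennreal_leI powr_mono2 spectral_norm_nonneg) auto
      qed
      then have "avg Q (\<lambda>y. ennreal (?N x y powr c)) \<le> ennreal (B powr c)"
        by (simp add: avg_const[OF cube])
      then have "ennreal_powr (avg Q (\<lambda>y. ennreal (?N x y powr c))) (q / c)
          \<le> ennreal_powr (ennreal (B powr c)) (q / c)"
        using q c by (intro ennreal_powr_mono) auto
      also have "\<dots> = ennreal (B powr q)"
        using c by (simp add: ennreal_powr_ennreal powr_powr)
      also have "B powr q = 8 powr q * (M powr (1/2) * \<bar>x\<bar> powr (-1/2))"
        using \<open>0 < M\<close> x(1) by (simp add: B_def powr_mult powr_powr \<kappa>(3) powr_divide powr_minus_divide)
      finally show "ennreal_powr (avg Q (\<lambda>y. ennreal (?N x y powr c))) (q / c)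
          \<le> ennreal (8 powr q) * ennreal (M powr (1/2) * \<bar>x\<bar> powr (-1/2))"
        by (simp add: ennreal_mult)
    qed
    also have "\<dots> = ennreal (8 powr q) * avg Q (\<lambda>x. ennreal (M powr (1/2) * \<bar>x\<bar> powr (-1/2)))"
      unfolding Q by (intro avg_cmult measurable_completion) measurable
    also have "\<dots> \<le> ennreal (8 powr q) * 8"
      unfolding Q by (intro mult_left_mono avg_inverse_sqrt_le[OF h M_def]) simp
    finally show ?thesis .
  qed
  then have "Apq_const p q (rotating_weight \<kappa>) \<le> ennreal (8 powr q) * 8"
    unfolding Apq_const_def c_def by (intro SUP_least)
  also have "\<dots> < \<infinity>"
    by (simp add: ennreal_mult_less_top)
  finally show ?thesis
    by (simp add: \<kappa>_def)
qed

text \<open>On \<open>[-h, h]\<close> the interaction of the left half with \<open>[h/2, h]\<close> is at least of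
  order \<open>h\<^bsup>\<kappa> - 1/(2 q)\<^esup>\<close>, which is unbounded as \<open>h\<close> tends to zero.\<close>

lemma Apq_const_rotating_weight_infinite:
  assumes p: "1 < p" and q: "0 < q" and \<kappa>: "0 < \<kappa>" "\<kappa> < 1 / (2 * q)"
  shows "Apq_const p q (rotating_weight \<kappa>) = \<infinity>"
proof -
  define c where "c = conj_exp p"
  define r where "r = q / c"
  define \<delta> where "\<delta> = 1 / (2 * q) - \<kappa>"
  let ?N = "\<lambda>x y. spectral_norm (mat_powr (rotating_weight \<kappa> x) (1/q) ** mat_powr (rotating_weight \<kappa> y) (- 1/q))"
  have c: "1 < c" and r: "0 < r" and \<delta>: "0 < \<delta>"
    using p q \<kappa> conj_exp_gt_1[OF p] by (auto simp: c_def r_def \<delta>_def)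
  have "ennreal B \<le> Apq_const p q (rotating_weight \<kappa>)" if B: "1 \<le> B" for B
  proof -
    \<comment> \<open>\<open>L\<close> is the size of the integrand that makes the average at least \<open>B\<close>,
      taking into account that \<open>[h/2, h]\<close> and \<open>[-h, 0)\<close> fill a quarter and a half of
      \<open>[-h, h]\<close>; then \<open>h\<close> is chosen so that the interaction has size \<open>L\<close>.\<close>
    define L where "L = (4 * (2 * B) powr (1/r)) powr (1/c)"
    have B2: "1 \<le> (2 * B) powr (1/r)"
      using B r by (intro ge_one_powr_ge_zero) auto
    have L1: "1 \<le> L"
      unfolding L_def using B2 c by (intro ge_one_powr_ge_zero) auto
    have L: "(L powr c / 4) powr r = 2 * B"
      using B r c B2 by (simp add: L_def powr_powr)
    define h where "h = (L * 2 powr \<kappa>) powr (- 1/\<delta>)"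
    have "1 * 1 \<le> L * 2 powr \<kappa>"
      using L1 \<kappa> by (intro mult_mono ge_one_powr_ge_zero) auto
    then have "1 \<le> (L * 2 powr \<kappa>) powr (1/\<delta>)"
      using \<delta> by (intro ge_one_powr_ge_zero) auto
    moreover have "h = 1 / (L * 2 powr \<kappa>) powr (1/\<delta>)"
      by (simp add: h_def powr_minus_divide)
    ultimately have h: "0 < h" "h \<le> 1"
      by (auto simp: divide_le_eq_1 intro: less_le_trans[of 0 1])
    have hL: "h powr (- 1 / (2 * q)) * (h / 2) powr \<kappa> = L"
    proof -
      have "h powr (- 1 / (2 * q)) * (h / 2) powr \<kappa> = h powr (- \<delta>) / 2 powr \<kappa>"
      proof -
        have "- \<delta> = - 1 / (2 * q) + \<kappa>"
          by (simp add: \<delta>_def)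
        then have "h powr (- \<delta>) = h powr (- 1 / (2 * q)) * h powr \<kappa>"
          by (simp only: powr_add)
        then show ?thesis
          using h by (simp add: powr_divide)
      qed
      also have "h powr (- \<delta>) = L * 2 powr \<kappa>"
        using \<delta> L1 by (simp add: h_def powr_powr)
      finally show ?thesis
        by simp
    qed
    define Q where "Q = {-h..h}"
    have Q: "Q \<in> cubes"
      using h by (auto simp: Q_def cubes_def intro!: exI[of _ "-h"] exI[of _ "2 * h"])
    have emeasures: "emeasure lebesgue {h/2..h} = ennreal (h/2)" "emeasure lebesgue {-h..<0} = ennreal h"
      "emeasure lebesgue Q = ennreal (2 * h)"
      using h by (simp_all add: Q_def)
    have N: "L \<le> ?N x y" if x: "x \<in> {-h..<0}" and y: "y \<in> {h/2..h}" for x y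
    proof -
      have "L = h powr (- (1/q)/2) * (h / 2) powr \<kappa>"
        using hL by (simp add: mult.commute)
      also have "\<dots> \<le> trunc_abs x powr (- (1/q)/2) * trunc_abs y powr \<kappa>"
        using x y h q \<kappa> by (intro mult_mono powr_mono2 powr_mono2') (auto simp: trunc_abs_def)
      also have "\<dots> \<le> spectral_norm (weight_product_core \<kappa> (1/q) x y)"
        using x y h \<kappa> by (intro weight_product_core_lower) auto
      also have "\<dots> = ?N x y"
        using spectral_norm_weight_product[OF \<kappa>(1), of x y "1/q"] x y h by simp
      finally show ?thesis .
    qed
    have inner: "ennreal (L powr c / 4) \<le> avg Q (\<lambda>y. ennreal (?N x y powr c))" if x: "x \<in> {-h..<0}" for x
    proof -
      have "ennreal (L powr c / 4) = ennreal (L powr c) * emeasure lebesgue {h/2..h} / emeasure lebesgue Q"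
        using h by (simp add: emeasures ennreal_mult_divide_ennreal)
      also have "\<dots> \<le> avg Q (\<lambda>y. ennreal (?N x y powr c))"
        using N[OF x] L1 c h by (intro avg_ge_on_subset ennreal_leI powr_mono2) (auto simp: Q_def)
      finally show ?thesis .
    qed
    have "ennreal B = ennreal (2 * B) * emeasure lebesgue {-h..<0} / emeasure lebesgue Q"
      using h B by (simp add: emeasures ennreal_mult_divide_ennreal)
    also have "\<dots> \<le> avg Q (\<lambda>x. ennreal_powr (avg Q (\<lambda>y. ennreal (?N x y powr c))) r)"
    proof (rule avg_ge_on_subset)
      fix x assume "x \<in> {-h..<0}"
      from ennreal_powr_mono[OF inner[OF this], of r]
      show "ennreal (2 * B) \<le> ennreal_powr (avg Q (\<lambda>y. ennreal (?N x y powr c))) r"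
        using r L by (simp add: ennreal_powr_ennreal)
    qed (use h in \<open>auto simp: Q_def\<close>)
    also have "\<dots> \<le> Apq_const p q (rotating_weight \<kappa>)"
      unfolding Apq_const_def c_def r_def using Q by (rule SUP_upper)
    finally show ?thesis .
  qed
  then have "ennreal (real n) \<le> Apq_const p q (rotating_weight \<kappa>)" for n
    by (cases "n = 0") (auto simp: le_numeral_extra)
  then show ?thesis
    using ennreal_SUP_of_nat_eq_top by (metis SUP_least ennreal_of_nat_eq_real_of_nat infinity_ennreal_def top.extremum_unique)
qed

section \<open>Comparison of the characteristics\<close>

text \<open>If \<open>p1 < p2\<close>, then \<open>p2' < p1'\<close> and the relation between the exponents gives
  \<open>q2 < q1\<close>. Hence \<open>\<kappa> = 1/(2 q1)\<close> is critical for the first pair of exponents and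
  lies below the critical value for the second.\<close>

theorem proposition1p5:
  fixes p1 p2 q1 q2 :: real
  assumes "1 < p1" "p1 \<le> q1" "1 < p2" "p2 \<le> q2"
    and "p1 \<le> p2"
    and "q1 / conj_exp p1 = q2 / conj_exp p2"
  shows "(\<forall>W :: real^'n \<Rightarrow> complex^'d^'d. matrix_weight W \<longrightarrow>
            Apq_const p1 q1 W \<le> Apq_const p2 q2 W) \<and>
         (p1 < p2 \<longrightarrow> (\<exists>W :: real \<Rightarrow> complex^2^2. matrix_weight W \<and>
            Apq_const p1 q1 W < \<infinity> \<and> Apq_const p2 q2 W = \<infinity>))"
proof (intro conjI allI impI)
  show "Apq_const p1 q1 W \<le> Apq_const p2 q2 W" if "matrix_weight W" for W :: "real^'n \<Rightarrow> complex^'d^'d"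
    using assms that by (intro Apq_const_mono)
next
  assume "p1 < p2"
  then have "conj_exp p2 < conj_exp p1"
    using assms(1,3) by (simp add: conj_exp_def field_simps)
  moreover have "q1 * conj_exp p2 = q2 * conj_exp p1"
    using assms(6) conj_exp_gt_1[OF assms(1)] conj_exp_gt_1[OF assms(3)] by (simp add: field_simps)
  moreover have q: "0 < q1" "0 < q2"
    using assms by auto
  ultimately have "q2 * conj_exp p2 < q1 * conj_exp p2"
    by simp
  then have "q2 < q1"
    using conj_exp_gt_1[OF assms(3)] by simp
  then have "1 / (2 * q1) < 1 / (2 * q2)"
    using q by (simp add: field_simps)
  with q show "\<exists>W :: real \<Rightarrow> complex^2^2. matrix_weight W \<and>
            Apq_const p1 q1 W < \<infinity> \<and> Apq_const p2 q2 W = \<infinity>"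
    using matrix_weight_rotating_weight Apq_const_rotating_weight_finite[OF assms(1) q(1)]
      Apq_const_rotating_weight_infinite[OF assms(3) q(2)]
    by (intro exI[of _ "rotating_weight (1 / (2 * q1))"]) auto
qed

end
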